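(* Let $\mathbb{K}$ be a commutative superring and $N\ge2$ an integer. The equation $$\varphi(u)\frac{\varphi(t+u)-\varphi(t)}{u}+\varphi(t)\frac{\varphi(t+u)-\varphi(u)}{t}=-\varphi(t+u)\quad\text{in }\mathbb{K}_0[t,u]/I_N,$$ where $I_N$ is the ideal generated by $\{t^iu^j:i+j\ge N-1\}$, has a solution $\varphi\in\mathbb{K}_0[t]/t^N$ with $\varphi(0)\in\mathbb{K}_0^\times$ if and only if $\frac12,\dots,\frac1N\in\mathbb{K}$. In this case, for each $c\in\mathbb{K}_0^\times$, the unique solution with $\varphi(0)=c$ is $$\varphi_c(t)\ \mathrm{mod}\ t^N,\qquad \varphi_c(t)=\frac{t}{e^{t/c}-1}.$$
   Context: A commutative superring $\mathbb{K}=\mathbb{K}_0\oplus\mathbb{K}_1$ is a unital $\mathbb{Z}/2$-graded ring with $ab=(-1)^{p(a)p(b)}ba$ for homogeneous $a,b$ of parities $p(a),p(b)$, and $a^2=0$ for $a\in\mathbb{K}_1$; $\mathbb{K}_0$ is a commutative ring and $\mathbb{K}_0^\times$ its group of units. $\frac1k\in\mathbb{K}$ means that the integer $k$ is invertible in $\mathbb{K}$. Both sides of the equation are well defined modulo $I_N$ for $\varphi$ given modulo $t^N$. If $2,\dots,N$ are invertible, $\varphi_c(t)\bmod t^N$ means $\sum_{k=0}^{N-1}\frac{b_k}{k!}c^{1-k}t^k$, where $\frac{z}{e^z-1}=\sum_k\frac{b_k}{k!}z^k$; the rational numbers $b_k/k!$ for $k\le N-1$ lie in $\mathbb{Z}[\frac1{N!}]$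 and so make sense in $\mathbb{K}$. *)

theory Defs
  imports
    "HOL-Algebra.Algebra"
    "HOL-Computational_Algebra.Formal_Power_Series"
begin

section \<open>Commutative superrings\<close>

text \<open>
  The grading is indexed by the residues \<open>0, 1\<close> modulo 2; \<open>G 0\<close> and \<open>G 1\<close> are the
  even and the odd part.  The zero ring is not excluded.
\<close>

locale comm_superring = ring K for K (structure) +
  fixes G :: "nat \<Rightarrow> 'a set"
  assumes grade_subgroup: "i < 2 \<Longrightarrow> additive_subgroup (G i) K"
    and grade_sum: "G 0 <+>\<^bsub>K\<^esub> G 1 = carrier K"
    and grade_disjoint: "G 0 \<inter> G 1 = {\<zero>}"
    and grade_mult: "\<lbrakk>i < 2; j < 2; a \<in> G i; b \<in> G j\<rbrakk> \<Longrightarrow> a \<otimes> b \<in> G ((i + j) mod 2)"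
    and supercommute: "\<lbrakk>i < 2; j < 2; a \<in> G i; b \<in> G j\<rbrakk> \<Longrightarrow>
          a \<otimes> b = ((\<ominus> \<one>) [^] (i * j)) \<otimes> (b \<otimes> a)"
    and odd_square: "a \<in> G 1 \<Longrightarrow> a \<otimes> a = \<zero>"

definition even_ring :: "('a, 'm) ring_scheme \<Rightarrow> (nat \<Rightarrow> 'a set) \<Rightarrow> ('a, 'm) ring_scheme" where
  "even_ring K G = K\<lparr>carrier := G 0\<rparr>"

context comm_superring
begin

lemma grade_closed: "i < 2 \<Longrightarrow> a \<in> G i \<Longrightarrow> a \<in> carrier K"
  using grade_subgroup additive_subgroup.a_Hcarr by fast

lemma one_even: "\<one> \<in> G 0"
proof -
  note One_nat_def [simp del]
  interpret G0: additive_subgroup "G 0" K by (rule grade_subgroup) simp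
  interpret G1: additive_subgroup "G 1" K by (rule grade_subgroup) simp
  have "\<one> \<in> G 0 <+>\<^bsub>K\<^esub> G 1" using grade_sum one_closed by simp
  then have "\<exists>e\<in>G 0. \<exists>d\<in>G 1. \<one> = e \<oplus> d" by (simp add: set_add_defs)
  then obtain e d where e: "e \<in> G 0" and d: "d \<in> G 1" and one: "\<one> = e \<oplus> d" by blast
  have ec: "e \<in> carrier K" and dc: "d \<in> carrier K"
    using e d grade_closed[of 0] grade_closed[of 1] by auto
  have ed0: "e \<otimes> d \<in> G 1" using grade_mult[of 0 1 e d] e d by simp
  have "e \<otimes> d = d \<otimes> e" using supercommute[of 0 1 e d] e d ec dc by simp
  have dd: "d \<otimes> d = \<zero>" by (rule odd_square[OF d])
  have "d = (e \<oplus> d) \<otimes> d" using dc by (simp add: one[symmetric])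
  also have "\<dots> = e \<otimes> d" using ec dc dd by (simp add: l_distr)
  finally have d1: "d = e \<otimes> d" .
  have "e = e \<otimes> (e \<oplus> d)" using ec by (simp add: one[symmetric])
  then have e1: "e = e \<otimes> e \<oplus> e \<otimes> d" using ec dc by (simp add: r_distr)
  have ee: "e \<otimes> e \<in> G 0" using grade_mult[of 0 0 e e] e by simp
  have "e = e \<otimes> e \<oplus> d" by (rule e1[folded d1])
  moreover have "d = \<ominus> (e \<otimes> e) \<oplus> (e \<otimes> e \<oplus> d)"
    by (rule r_neg1[symmetric]) (use ec dc in blast)+
  ultimately have "d = \<ominus> (e \<otimes> e) \<oplus> e" by (rule subst[of _ _ "\<lambda>x. d = _ \<oplus> x", OF sym])
  also have "\<dots> \<in> G 0" using e ee G0.a_closed G0.a_inv_closed by blast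
  finally have "d = \<zero>" using d grade_disjoint by blast
  then show ?thesis using one e ec by simp
qed

lemma even_cring: "cring (even_ring K G)"
proof -
  interpret G0: additive_subgroup "G 0" K by (rule grade_subgroup) simp
  have m: "a \<otimes> b \<in> G 0" if "a \<in> G 0" "b \<in> G 0" for a b
    using grade_mult[of 0 0 a b] that by simp
  have "subring (G 0) K"
    by (rule subringI) (use one_even m grade_closed[of 0] G0.a_inv_closed G0.a_closed in auto)
  moreover have "a \<otimes> b = b \<otimes> a" if "a \<in> G 0" "b \<in> G 0" for a b
    using supercommute[of 0 0 a b] that grade_closed[of 0] by simp
  ultimately have "subcring (G 0) K" by (rule subcringI)
  then show ?thesis unfolding even_ring_def by (rule subcring_iff[THEN iffD1, rotated])
      (use grade_closed[of 0] in auto)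
qed

end

section \<open>The functional equation\<close>

text \<open>
  \<open>R[t]\<close> is \<open>UP R\<close>; \<open>R[t, u]\<close> is \<open>UP (UP R)\<close>, with \<open>u\<close> the outer variable.
\<close>

definition trunc_ideal :: "('a, 'm) ring_scheme \<Rightarrow> nat \<Rightarrow> (nat \<Rightarrow> 'a) set" where
  "trunc_ideal R N = PIdl\<^bsub>UP R\<^esub> (up_ring.monom (UP R) \<one>\<^bsub>R\<^esub> N)"

abbreviation trunc_poly :: "('a, 'm) ring_scheme \<Rightarrow> nat \<Rightarrow> (nat \<Rightarrow> 'a) set ring" where
  "trunc_poly R N \<equiv> UP R Quot trunc_ideal R N"

text \<open>Evaluation at \<open>0\<close> is constant on every class modulo \<open>t ^ N\<close> when \<open>N \<ge> 1\<close>.\<close>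

definition value_at_0 :: "('a, 'm) ring_scheme \<Rightarrow> (nat \<Rightarrow> 'a) set \<Rightarrow> 'a" where
  "value_at_0 R \<Phi> = the_elem (eval R R id \<zero>\<^bsub>R\<^esub> ` \<Phi>)"

abbreviation UP2 :: "('a, 'm) ring_scheme \<Rightarrow> (nat \<Rightarrow> 'a, nat \<Rightarrow> nat \<Rightarrow> 'a) up_ring" where
  "UP2 R \<equiv> UP (UP R)"

definition var_t :: "('a, 'm) ring_scheme \<Rightarrow> nat \<Rightarrow> nat \<Rightarrow> 'a" where
  "var_t R = up_ring.monom (UP2 R) (up_ring.monom (UP R) \<one>\<^bsub>R\<^esub> 1) 0"

definition var_u :: "('a, 'm) ring_scheme \<Rightarrow> nat \<Rightarrow> nat \<Rightarrow> 'a" where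
  "var_u R = up_ring.monom (UP2 R) \<one>\<^bsub>UP R\<^esub> 1"

definition const2 :: "('a, 'm) ring_scheme \<Rightarrow> 'a \<Rightarrow> nat \<Rightarrow> nat \<Rightarrow> 'a" where
  "const2 R a = up_ring.monom (UP2 R) (up_ring.monom (UP R) a 0) 0"

text \<open>\<open>subst2 R p s\<close> is \<open>p(s)\<close>, for \<open>p\<close> in \<open>R[t]\<close> and \<open>s\<close> in \<open>R[t, u]\<close>.\<close>

definition subst2 ::
  "('a, 'm) ring_scheme \<Rightarrow> (nat \<Rightarrow> 'a) \<Rightarrow> (nat \<Rightarrow> nat \<Rightarrow> 'a) \<Rightarrow> nat \<Rightarrow> nat \<Rightarrow> 'a" where
  "subst2 R p s = eval R (UP2 R) (const2 R) s p"

text \<open>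
  Only used with \<open>b\<close> one of the variables of \<open>R[t, u]\<close> and \<open>a\<close> a multiple of \<open>b\<close>;
  a variable is not a zero divisor, so the quotient is unique.
\<close>

definition exact_quotient :: "('a, 'm) ring_scheme \<Rightarrow> 'a \<Rightarrow> 'a \<Rightarrow> 'a" where
  "exact_quotient S a b = (THE q. q \<in> carrier S \<and> b \<otimes>\<^bsub>S\<^esub> q = a)"

definition eqn_lhs :: "('a, 'm) ring_scheme \<Rightarrow> (nat \<Rightarrow> 'a) \<Rightarrow> nat \<Rightarrow> nat \<Rightarrow> 'a" where
  "eqn_lhs R p =
    (let S = UP2 R; t = var_t R; u = var_u R;
         pt = subst2 R p t; pu = subst2 R p u; ptu = subst2 R p (t \<oplus>\<^bsub>S\<^esub> u)
     in (pu \<otimes>\<^bsub>S\<^esub> exact_quotient S (ptu \<ominus>\<^bsub>S\<^esub> pt) u) \<oplus>\<^bsub>S\<^esub>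
        (pt \<otimes>\<^bsub>S\<^esub> exact_quotient S (ptu \<ominus>\<^bsub>S\<^esub> pu) t))"

definition eqn_rhs :: "('a, 'm) ring_scheme \<Rightarrow> (nat \<Rightarrow> 'a) \<Rightarrow> nat \<Rightarrow> nat \<Rightarrow> 'a" where
  "eqn_rhs R p = \<ominus>\<^bsub>UP2 R\<^esub> subst2 R p (var_t R \<oplus>\<^bsub>UP2 R\<^esub> var_u R)"

definition ideal_I :: "('a, 'm) ring_scheme \<Rightarrow> nat \<Rightarrow> (nat \<Rightarrow> nat \<Rightarrow> 'a) set" where
  "ideal_I R N = Idl\<^bsub>UP2 R\<^esub>
     {(var_t R [^]\<^bsub>UP2 R\<^esub> i) \<otimes>\<^bsub>UP2 R\<^esub> (var_u R [^]\<^bsub>UP2 R\<^esub> j) | i j :: nat. i + j \<ge> N - 1}"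

text \<open>
  Modulo \<open>ideal_I R N\<close> both sides depend only on the class of \<open>p\<close> modulo \<open>t ^ N\<close>, and
  classes are nonempty, so it does not matter which representatives are tested.
\<close>

definition is_solution :: "('a, 'm) ring_scheme \<Rightarrow> nat \<Rightarrow> (nat \<Rightarrow> 'a) set \<Rightarrow> bool" where
  "is_solution R N \<Phi> \<longleftrightarrow> \<Phi> \<in> carrier (trunc_poly R N) \<and>
     (\<forall>p\<in>\<Phi>. ideal_I R N +>\<^bsub>UP2 R\<^esub> eqn_lhs R p = ideal_I R N +>\<^bsub>UP2 R\<^esub> eqn_rhs R p)"

section \<open>The solutions\<close>

definition int_invertible :: "('a, 'm) ring_scheme \<Rightarrow> nat \<Rightarrow> bool" where
  "int_invertible R k \<longleftrightarrow> add_pow R k \<one>\<^bsub>R\<^esub> \<in> Units R"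

definition bernoulli_number :: "nat \<Rightarrow> rat" where
  "bernoulli_number k = fact k * fps_nth (fps_X / (fps_exp 1 - 1)) k"

text \<open>
  The image of a rational number in \<open>R\<close>; meaningful if its reduced denominator is invertible
  in \<open>R\<close>.
\<close>

definition rat_in :: "('a, 'm) ring_scheme \<Rightarrow> rat \<Rightarrow> 'a" where
  "rat_in R q = (case quotient_of q of (m, n) \<Rightarrow>
     add_pow R m \<one>\<^bsub>R\<^esub> \<otimes>\<^bsub>R\<^esub> inv\<^bsub>R\<^esub> (add_pow R n \<one>\<^bsub>R\<^esub>))"

text \<open>The class of \<open>t / (exp (t / c) - 1)\<close> modulo \<open>t ^ N\<close>.\<close>

definition phi_trunc :: "('a, 'm) ring_scheme \<Rightarrow> nat \<Rightarrow> 'a \<Rightarrow> (nat \<Rightarrow> 'a) set" where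
  "phi_trunc R N c = trunc_ideal R N +>\<^bsub>UP R\<^esub>
     (\<Oplus>\<^bsub>UP R\<^esub>k\<in>{..<N}. up_ring.monom (UP R)
        (rat_in R (bernoulli_number k / fact k) \<otimes>\<^bsub>R\<^esub> (c [^]\<^bsub>R\<^esub> (1 - int k))) k)"

end

theory Submission
  imports Defs "HOL-Computational_Algebra.Polynomial"
begin

text \<open>
  Write \<open>b k\<close> for the coefficients of \<open>z / (exp z - 1)\<close>.  Over the rational numbers the functional
  equation for this series is a rational identity between exponentials, and it is homogeneous in
  the sense that \<open>b k\<close> may be replaced by \<open>b k * c ^ (1 - k)\<close>.  Since the coefficients only involve
  the denominators \<open>2, \<dots>, N\<close>, the solution carries over to every ring in which these are
  invertible.  Conversely, the coefficient of \<open>t ^ 0 u ^ (n - 1)\<close> of the equation expresses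
  \<open>(n + 1) a 0 a n\<close> through \<open>a 0, \<dots>, a (n - 1)\<close>.  If \<open>2, \<dots>, n\<close> are invertible and \<open>a k\<close> has the
  expected value for \<open>k < n\<close>, then \<open>(n + 1) a n = ((n + 1) b n) c ^ (1 - n)\<close>.  By the recursion for
  the Bernoulli numbers, \<open>(n + 1) b n\<close> is \<open>- 1 / n!\<close> modulo \<open>n + 1\<close>, hence \<open>n + 1\<close> divides a unit;
  so \<open>n + 1\<close> is invertible and \<open>a n\<close> is determined.
\<close>

section \<open>Bernoulli numbers\<close>

text \<open>The factorial in \<open>bernoulli_number\<close> cancels, so this is the coefficient of
  z^k in z / (exp z - 1), in the convention with b 1 = -1/2.\<close>

definition bernoulli_coeff :: "nat \<Rightarrow> rat" where
  "bernoulli_coeff k = bernoulli_number k / fact k"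

lemma fps_exp_minus_1_nonzero:
  assumes "y \<noteq> (0 :: 'a :: field_char_0)"
  shows "fps_exp y - 1 \<noteq> 0"
proof
  assume "fps_exp y - 1 = 0"
  then have "fps_nth (fps_exp y - 1) 1 = 0" by simp
  with assms show False by simp
qed

text \<open>Numerator and denominator both have subdegree 1, so the quotient of power series is
  exact and the denominator can be cleared.\<close>

lemma bernoulli_coeff_fps:
  "Abs_fps bernoulli_coeff * (fps_exp 1 - 1) = fps_X"
proof -
  have "fps_exp 1 - 1 \<noteq> (0 :: rat fps)"
    by (rule fps_exp_minus_1_nonzero) simp
  moreover have "subdegree (fps_exp 1 - 1 :: rat fps) = 1"
    by (rule subdegreeI) auto
  ultimately have "fps_exp 1 - 1 dvd (fps_X :: rat fps)"
    by (subst fps_dvd_iff) auto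
  moreover have "Abs_fps bernoulli_coeff = fps_X / (fps_exp 1 - 1)"
    by (rule fps_ext) (simp add: bernoulli_coeff_def bernoulli_number_def)
  ultimately show ?thesis
    by simp
qed

text \<open>Compare coefficients of z^(n+1); the vanishing constant term of exp z - 1 stops the sum
  at n. The recursion later controls the denominators of b n and determines (n + 1) b n modulo n +
  1.\<close>

lemma bernoulli_coeff_rec:
  "(\<Sum>k\<le>n. bernoulli_coeff k / fact (n + 1 - k)) = (if n = 0 then 1 else 0)"
proof -
  have "fps_nth (Abs_fps bernoulli_coeff * (fps_exp 1 - 1)) (Suc n) = (if n = 0 then 1 else 0)"
    unfolding bernoulli_coeff_fps by simp
  also have "fps_nth (Abs_fps bernoulli_coeff * (fps_exp 1 - 1)) (Suc n)
      = (\<Sum>k\<le>n. bernoulli_coeff k / fact (n + 1 - k))"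
    unfolding fps_mult_nth atLeast0AtMost
    by (auto simp: Suc_diff_le intro!: sum.cong)
  finally show ?thesis .
qed

lemma bernoulli_coeff_0: "bernoulli_coeff 0 = 1"
  using bernoulli_coeff_rec[of 0] by simp

section \<open>The functional equation over the rational numbers\<close>

lemma sum_triangle_swap:
  fixes n :: nat
  shows "(\<Sum>k\<le>n. \<Sum>i\<le>n - k. g k i) = (\<Sum>i\<le>n. \<Sum>k\<le>n - i. g k i)"
  unfolding sum.Sigma[OF finite_atMost ballI[OF finite_atMost]]
  by (rule sum.reindex_bij_witness[of _ "\<lambda>(x, y). (y, x)" "\<lambda>(x, y). (y, x)"]) auto

lemma sum_triangle_diagonal:
  fixes n :: nat
  shows "(\<Sum>k\<le>n. \<Sum>i\<le>n - k. g k i) = (\<Sum>m\<le>n. \<Sum>k\<le>m. g k (m - k))"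
  unfolding sum.Sigma[OF finite_atMost ballI[OF finite_atMost]]
  by (rule sum.reindex_bij_witness[of _ "\<lambda>(m, k). (k, m - k)" "\<lambda>(k, i). (k + i, k)"]) auto

text \<open>A nonzero polynomial over a domain has finitely many roots, while characteristic 0 makes
  the positive integers infinitely many points.\<close>

lemma sum_powers_eq_0D:
  fixes a :: "nat \<Rightarrow> 'a :: {idom, ring_char_0}"
  assumes "\<And>x. x > 0 \<Longrightarrow> (\<Sum>i\<le>n. a i * of_nat x ^ i) = 0" and "i \<le> n"
  shows "a i = 0"
proof -
  define p where "p = (\<Sum>i\<le>n. Polynomial.monom (a i) i)"
  have "of_nat ` {0<..} \<subseteq> {x. poly p x = 0}"
    using assms(1) by (auto simp: p_def poly_sum poly_monom)
  moreover have "infinite (of_nat ` {0<..} :: 'a set)"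
    by (subst finite_image_iff) (auto simp: infinite_Ioi inj_on_def)
  ultimately have "p = 0"
    using poly_roots_finite finite_subset by metis
  then have "Polynomial.coeff p i = 0" by simp
  then show ?thesis
    using assms(2) by (simp add: p_def coeff_sum)
qed

lemma bernoulli_coeff_scaled:
  "Abs_fps (\<lambda>n. x ^ n * bernoulli_coeff n) * (fps_exp x - 1) = fps_const x * fps_X"
proof -
  have "(Abs_fps bernoulli_coeff * (fps_exp 1 - 1)) oo (fps_const x * fps_X)
      = fps_X oo (fps_const x * fps_X)"
    by (simp only: bernoulli_coeff_fps)
  moreover have "Abs_fps bernoulli_coeff oo (fps_const x * fps_X) = Abs_fps (\<lambda>n. x ^ n * bernoulli_coeff n)"
    by (simp add: fps_compose_linear)
  ultimately show ?thesis
    by (simp add: fps_compose_mult_distrib fps_compose_sub_distrib)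
qed

text \<open>Here f, g, h stand for phi(t), phi(u), phi(t + u), the elements a, b, d for exp t - 1,
  exp u - 1, exp (t + u) - 1, and q, r for the difference quotients. The relation for d is exp (t +
  u) = exp t * exp u; multiplying by a b d clears all denominators.\<close>

lemma functional_equation_cancel:
  fixes a b d f g h q r t u :: "'a :: idom"
  assumes "g * b = u" "f * a = t" "h * d = t + u" "d = a * b + a + b"
    and "u * q = h - f" "t * r = h - g" and nz: "a \<noteq> 0" "b \<noteq> 0" "d \<noteq> 0"
  shows "g * q + f * r = - h"
proof -
  have "(a * b * d) * (g * q + f * r) = a * d * ((g * b) * q) + b * d * ((f * a) * r)"
    by (simp add: algebra_simps)
  also have "\<dots> = a * d * (h - f) + b * d * (h - g)"
    by (simp only: assms(1,2,5,6))
  also have "\<dots> = a * (h * d) - d * (f * a) + b * (h * d) - d * (g * b)"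
    by (simp add: algebra_simps)
  also have "\<dots> = a * (t + u) - d * t + b * (t + u) - d * u"
    by (simp only: assms(1-3))
  also have "\<dots> = (a + b - d) * (t + u)"
    by (simp add: algebra_simps)
  also have "\<dots> = - (a * b) * (h * d)"
    by (simp only: assms(3)) (simp add: assms(4))
  finally have "(a * b * d) * (g * q + f * r) = (a * b * d) * (- h)"
    by (simp add: algebra_simps)
  then show ?thesis using nz by (simp only: mult_cancel_left mult_eq_0_iff simp_thms)
qed

text \<open>
  The rational form of the functional equation is read off from the identity of power series in
  one variable \<open>z\<close> obtained by substituting \<open>t = x z\<close>, \<open>u = z\<close>, for infinitely many \<open>x\<close>.
\<close>

lemma bernoulli_coeff_equation:
  "(\<Sum>k\<le>j. bernoulli_coeff k * (of_nat ((i + (j - k) + 1) choose i) * bernoulli_coeff (i + (j - k) + 1)))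
   + (\<Sum>k\<le>i. bernoulli_coeff k * (of_nat (((i - k) + j + 1) choose j) * bernoulli_coeff ((i - k) + j + 1)))
   = - (of_nat ((i + j) choose i) * bernoulli_coeff (i + j))"
proof -
  define b where "b = bernoulli_coeff"
  define n where "n = i + j"
  \<comment> \<open>The difference of both sides at the exponents \<open>i\<close> and
    \<open>n - i\<close>; for fixed \<open>n\<close> these numbers are treated as the coefficients
    of a polynomial in x.\<close>
  define e where "e i = (\<Sum>k\<le>n - i. b k * (of_nat ((i + (n - i - k) + 1) choose i) * b (i + (n - i - k) + 1)))
   + (\<Sum>k\<le>i. b k * (of_nat (((i - k) + (n - i) + 1) choose (n - i)) * b ((i - k) + (n - i) + 1)))
   + of_nat (n choose i) * b n" for i
  have "e i = 0"
  proof (rule sum_powers_eq_0D[where n = n])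
    fix m :: nat assume "m > 0"
    define x :: rat where "x = of_nat m"
    \<comment> \<open>Positivity of \<open>m\<close> keeps x and x + 1 away from 0, so that exp (x
      z) - 1 and exp ((x + 1) z) - 1 can be cancelled.\<close>
    have x: "x \<noteq> 0" "x + 1 \<noteq> 0" using \<open>m > 0\<close> by (auto simp: x_def simp flip: of_nat_Suc)
    \<comment> \<open>\<open>F y\<close> is phi(y z), so \<open>F x\<close>, \<open>F 1\<close>,
      \<open>F (x + 1)\<close> are phi(t), phi(u), phi(t + u) for t = x z and u = z. The series
      \<open>q\<close> and \<open>r\<close> are the two difference quotients, expanded by the
      binomial theorem.\<close>
    define F where "F y = Abs_fps (\<lambda>n. y ^ n * b n)" for y
    define q where "q = Abs_fps (\<lambda>n. \<Sum>i\<le>n. of_nat (Suc n choose i) * b (Suc n) * x ^ i)"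
    define r where "r = Abs_fps (\<lambda>n. \<Sum>i\<le>n. of_nat (Suc n choose (n - i)) * b (Suc n) * x ^ i)"
    have F: "F y * (fps_exp y - 1) = fps_const y * fps_X" for y
      unfolding F_def b_def by (rule bernoulli_coeff_scaled)
    have binom: "(x + 1) ^ k = (\<Sum>i\<le>k. of_nat (k choose i) * x ^ i)" for k
      using binomial_ring[of x 1 k] by simp
    have q: "fps_X * q = F (x + 1) - F x"
    proof (rule fps_ext)
      fix k
      show "fps_nth (fps_X * q) k = fps_nth (F (x + 1) - F x) k"
      proof (cases k)
        case (Suc l)
        have "(x + 1) ^ Suc l = (\<Sum>i\<le>l. of_nat (Suc l choose i) * x ^ i) + x ^ Suc l"
          by (simp only: binom sum.atMost_Suc) simp
        then have "(x + 1) ^ Suc l * b (Suc l) - x ^ Suc l * b (Suc l)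
            = (\<Sum>i\<le>l. of_nat (Suc l choose i) * x ^ i) * b (Suc l)"
          by (simp only: distrib_right add_diff_cancel)
        then show ?thesis
          by (simp add: Suc q_def F_def sum_distrib_left sum_distrib_right mult_ac del: power_Suc binomial_Suc_Suc)
      qed (simp add: F_def)
    qed
    have r: "(fps_const x * fps_X) * r = F (x + 1) - F 1"
    proof (rule fps_ext)
      fix k
      show "fps_nth ((fps_const x * fps_X) * r) k = fps_nth (F (x + 1) - F 1) k"
      proof (cases k)
        case (Suc l)
        have "(x + 1) ^ Suc l = 1 + (\<Sum>i\<le>l. of_nat (Suc l choose Suc i) * x ^ Suc i)"
          by (simp only: binom sum.atMost_Suc_shift) simp
        moreover have "Suc l choose (l - i) = Suc l choose Suc i" if "i \<le> l" for i
          using that by (metis Suc_le_mono binomial_symmetric diff_Suc_Suc)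
        ultimately have "(x + 1) ^ Suc l * b (Suc l) - b (Suc l)
            = (\<Sum>i\<le>l. of_nat (Suc l choose (l - i)) * x ^ Suc i) * b (Suc l)"
          by (simp add: distrib_right del: power_Suc binomial_Suc_Suc)
        then show ?thesis
          by (simp add: Suc r_def F_def sum_distrib_right sum_distrib_left mult_ac mult.assoc fps_X_mult_nth
             del: binomial_Suc_Suc)
      qed (simp add: F_def)
    qed
    have "F 1 * q + F x * r = - F (x + 1)"
    proof (rule functional_equation_cancel[OF _ F _ _ q r fps_exp_minus_1_nonzero fps_exp_minus_1_nonzero fps_exp_minus_1_nonzero])
      show "F 1 * (fps_exp 1 - 1) = fps_X" using F[of 1] by simp
      show "F (x + 1) * (fps_exp (x + 1) - 1) = fps_const x * fps_X + fps_X"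
        unfolding F by (simp add: algebra_simps flip: fps_const_add)
      show "fps_exp (x + 1) - 1 = (fps_exp x - 1) * (fps_exp 1 - 1) + (fps_exp x - 1) + (fps_exp 1 - 1)"
        by (simp add: fps_exp_add_mult algebra_simps)
    qed (use x in auto)
    then have "0 = fps_nth (F 1 * q + F x * r + F (x + 1)) n" by simp
    also have "\<dots> = (\<Sum>k\<le>n. \<Sum>i\<le>n - k. b k * (of_nat (Suc (n - k) choose i) * b (Suc (n - k)) * x ^ i))
       + (\<Sum>k\<le>n. \<Sum>i\<le>n - k. b k * (of_nat (Suc (n - k) choose (n - k - i)) * b (Suc (n - k)) * x ^ (k + i)))
       + (x + 1) ^ n * b n"
      by (simp add: F_def q_def r_def fps_mult_nth sum_distrib_left atLeast0AtMost power_add mult_ac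
          del: binomial_Suc_Suc power_Suc)
    \<comment> \<open>In the first product the power of x is \<open>i\<close> itself, so the sums
      are interchanged; in the second it is \<open>k + i\<close>, so they are regrouped along
      diagonals.\<close>
    also have "(\<Sum>k\<le>n. \<Sum>i\<le>n - k. b k * (of_nat (Suc (n - k) choose i) * b (Suc (n - k)) * x ^ i))
       = (\<Sum>i\<le>n. (\<Sum>k\<le>n - i. b k * (of_nat ((i + (n - i - k) + 1) choose i) * b (i + (n - i - k) + 1))) * x ^ i)"
      by (subst sum_triangle_swap) (auto simp: sum_distrib_left sum_distrib_right mult_ac Suc_diff_le  simp del: binomial_Suc_Suc
          intro!: sum.cong)
    also have "(\<Sum>k\<le>n. \<Sum>i\<le>n - k. b k * (of_nat (Suc (n - k) choose (n - k - i)) * b (Suc (n - k)) * x ^ (k + i)))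
       = (\<Sum>i\<le>n. (\<Sum>k\<le>i. b k * (of_nat (((i - k) + (n - i) + 1) choose (n - i)) * b ((i - k) + (n - i) + 1))) * x ^ i)"
      by (subst sum_triangle_diagonal) (auto simp: sum_distrib_left sum_distrib_right mult_ac simp del: binomial_Suc_Suc
          intro!: sum.cong)
    also have "(x + 1) ^ n * b n = (\<Sum>i\<le>n. of_nat (n choose i) * b n * x ^ i)"
      by (simp add: binom sum_distrib_left sum_distrib_right mult_ac)
    finally show "(\<Sum>i\<le>n. e i * of_nat m ^ i) = 0"
      by (simp only: e_def x_def[symmetric] distrib_right sum.distrib)
  qed (simp add: n_def)
  then show ?thesis
    by (simp add: e_def n_def b_def eq_neg_iff_add_eq_0)
qed

section \<open>Rational numbers in a commutative ring\<close>

context cring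
begin

lemma unit_divisor:
  assumes "a \<in> carrier R" "b \<in> carrier R" "a \<otimes> b \<in> Units R"
  shows "a \<in> Units R"
proof -
  obtain x where x: "x \<in> carrier R" "(a \<otimes> b) \<otimes> x = \<one>"
    using assms(3) Units_r_inv_ex by blast
  then have "a \<otimes> (b \<otimes> x) = \<one>" using assms by (simp add: m_assoc)
  moreover from this have "(b \<otimes> x) \<otimes> a = \<one>" using assms x by (simp add: m_comm)
  ultimately show ?thesis using assms x unfolding Units_def by blast
qed

abbreviation int_in :: "int \<Rightarrow> 'a" where
  "int_in m \<equiv> add_pow R m \<one>"

lemma int_in_closed [simp]: "int_in m \<in> carrier R"
  by (simp add: add.int_pow_closed)

lemma int_in_add: "int_in (m + n) = int_in m \<oplus> int_in n"
  by (simp add: add.int_pow_mult)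

lemma int_in_neg: "int_in (- m) = \<ominus> int_in m"
  by (simp add: add.int_pow_neg)

lemma int_in_1 [simp]: "int_in 1 = \<one>"
  by (simp add: add.int_pow_1)

lemma int_in_0 [simp]: "int_in 0 = \<zero>"
  by (simp add: add_pow_int_ge)

lemma int_in_of_nat: "int_in (int n) = add_pow R n \<one>"
  by (simp add: add_pow_int_ge)

lemma int_in_mult_left: "a \<in> carrier R \<Longrightarrow> int_in m \<otimes> a = add_pow R m a"
  by (simp add: add_pow_ldistr_int)

lemma int_in_of_nat_mult: "a \<in> carrier R \<Longrightarrow> int_in (int n) \<otimes> a = add_pow R n a"
  by (simp add: int_in_of_nat add_pow_ldistr)

lemma int_in_mult: "int_in (m * n) = int_in m \<otimes> int_in n"
  using add.int_pow_pow[of \<one> m n] by (simp add: int_in_mult_left mult.commute)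

section \<open>The partial homomorphism from the rational numbers to the ring\<close>

definition rat_dom :: "rat \<Rightarrow> bool" where
  "rat_dom q \<longleftrightarrow> int_in (snd (quotient_of q)) \<in> Units R"

text \<open>The reduced denominator divides every other denominator n, and a divisor of a unit is a
  unit. Hence any fraction with invertible denominator may be used, not only the reduced
  one.\<close>

lemma rat_in_fraction:
  assumes n: "n \<noteq> 0" "int_in n \<in> Units R" and q: "q * of_int n = of_int m"
  shows "rat_dom q" and "rat_in R q \<in> carrier R" and "rat_in R q \<otimes> int_in n = int_in m"
proof -
  obtain a b where ab: "quotient_of q = (a, b)" by (cases "quotient_of q")
  have b: "b > 0" and cop: "coprime a b" and qab: "q = of_int a / of_int b"
    using quotient_of_denom_pos[OF ab] quotient_of_coprime[OF ab] quotient_of_div[OF ab] by auto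
  have "of_int (a * n) = (of_int (m * b) :: rat)"
    using q b by (simp add: qab field_simps)
  then have eq: "a * n = m * b" by (simp only: of_int_eq_iff)
  then have "b dvd n" using cop by (metis coprime_commute coprime_dvd_mult_right_iff dvd_triv_right)
  then obtain k where k: "n = b * k" by blast
  with eq b have mk: "m = a * k" by (simp add: mult.left_commute)
  have unit: "int_in b \<in> Units R"
    using n(2) unit_divisor[of "int_in b" "int_in k"] by (simp add: k int_in_mult)
  then show "rat_dom q" by (simp add: rat_dom_def ab)
  have r: "rat_in R q = int_in a \<otimes> inv (int_in b)" by (simp add: rat_in_def ab)
  show c: "rat_in R q \<in> carrier R" using unit by (simp add: r)
  have "inv (int_in b) \<otimes> (int_in b \<otimes> int_in k) = int_in k"
    using unit by (simp flip: m_assoc)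
  then show "rat_in R q \<otimes> int_in n = int_in m"
    using unit by (simp add: r k mk int_in_mult m_assoc)
qed

lemma rat_domE:
  assumes "rat_dom q"
  obtains m n where "n \<noteq> 0" "int_in n \<in> Units R" "q * of_int n = of_int m"
proof -
  obtain a b where ab: "quotient_of q = (a, b)" by (cases "quotient_of q")
  have "b > 0" "q = of_int a / of_int b"
    using quotient_of_denom_pos[OF ab] quotient_of_div[OF ab] by auto
  then have "b \<noteq> 0" "q * of_int b = of_int a" by auto
  moreover have "int_in b \<in> Units R" using assms by (simp add: rat_dom_def ab)
  ultimately show thesis using that by blast
qed

lemma rat_in_closed [simp]: "rat_dom q \<Longrightarrow> rat_in R q \<in> carrier R"
  using rat_domE rat_in_fraction(2) by metis

lemma rat_in_unique:
  assumes "n \<noteq> 0" "int_in n \<in> Units R" "q * of_int n = of_int m"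
    and z: "z \<in> carrier R" "z \<otimes> int_in n = int_in m"
  shows "rat_in R q = z"
proof -
  have "int_in n \<otimes> rat_in R q = int_in n \<otimes> z"
    using rat_in_fraction[OF assms(1-3)] z by (simp add: m_comm)
  then show ?thesis
    using Units_l_cancel[OF assms(2)] rat_in_fraction(2)[OF assms(1-3)] z(1) by blast
qed

text \<open>Both operations are checked over the common denominator \<open>b * d\<close>, a unit
  because \<open>b\<close> and \<open>d\<close> are; \<open>rat_in_unique\<close> then makes
  reducing fractions unnecessary.\<close>

lemma
  assumes x: "rat_dom x" and y: "rat_dom y"
  shows rat_dom_add: "rat_dom (x + y)" and rat_in_add: "rat_in R (x + y) = rat_in R x \<oplus> rat_in R y"
    and rat_dom_mult: "rat_dom (x * y)" and rat_in_mult: "rat_in R (x * y) = rat_in R x \<otimes> rat_in R y"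
proof -
  obtain a b where a: "b \<noteq> 0" "int_in b \<in> Units R" "x * of_int b = of_int a" using x by (rule rat_domE)
  obtain c d where c: "d \<noteq> 0" "int_in d \<in> Units R" "y * of_int d = of_int c" using y by (rule rat_domE)
  note X = rat_in_fraction[OF a] and Y = rat_in_fraction[OF c]
  have bd: "b * d \<noteq> 0" "int_in (b * d) \<in> Units R" using a c by (auto simp: int_in_mult)
  have "(x + y) * of_int (b * d) = (x * of_int b) * of_int d + (y * of_int d) * of_int b"
    by (simp add: algebra_simps)
  then have sum: "(x + y) * of_int (b * d) = of_int (a * d + c * b)"
    by (simp only: a c of_int_add of_int_mult)
  have "(x * y) * of_int (b * d) = (x * of_int b) * (y * of_int d)"
    by (simp add: algebra_simps)
  then have prod: "(x * y) * of_int (b * d) = of_int (a * c)"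
    by (simp only: a c of_int_mult)
  show "rat_dom (x + y)" by (rule rat_in_fraction(1)[OF bd sum])
  show "rat_dom (x * y)" by (rule rat_in_fraction(1)[OF bd prod])
  have "(rat_in R x \<oplus> rat_in R y) \<otimes> int_in (b * d)
      = (rat_in R x \<otimes> int_in b) \<otimes> int_in d \<oplus> (rat_in R y \<otimes> int_in d) \<otimes> int_in b"
    unfolding int_in_mult using X(2) Y(2) by (simp add: l_distr m_assoc m_comm[of "int_in b" "int_in d"])
  then show "rat_in R (x + y) = rat_in R x \<oplus> rat_in R y"
    using X(2) Y(2) by (intro rat_in_unique[OF bd sum]) (simp_all add: X(3) Y(3) int_in_add int_in_mult)
  have "(rat_in R x \<otimes> rat_in R y) \<otimes> int_in (b * d) = (rat_in R x \<otimes> int_in b) \<otimes> (rat_in R y \<otimes> int_in d)"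
    unfolding int_in_mult using X(2) Y(2) by (simp add: m_assoc m_lcomm[of "rat_in R y"])
  then show "rat_in R (x * y) = rat_in R x \<otimes> rat_in R y"
    using X(2) Y(2) by (intro rat_in_unique[OF bd prod]) (simp_all add: X(3) Y(3) int_in_mult)
qed

lemma rat_dom_of_int [simp]: "rat_dom (of_int m)"
  and rat_in_of_int: "rat_in R (of_int m) = int_in m"
  using rat_in_fraction(1)[of 1 "of_int m" m] rat_in_unique[of 1 "of_int m" m "int_in m"] by simp_all

lemma rat_dom_of_nat [simp]: "rat_dom (of_nat n)"
  and rat_in_of_nat: "rat_in R (of_nat n) = int_in (int n)"
  using rat_dom_of_int[of "int n"] rat_in_of_int[of "int n"] by simp_all

lemma
  assumes "rat_dom x"
  shows rat_dom_neg: "rat_dom (- x)" and rat_in_neg: "rat_in R (- x) = \<ominus> rat_in R x"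
  using rat_dom_mult[OF rat_dom_of_int[of "-1"] assms] rat_in_mult[OF rat_dom_of_int[of "-1"] assms] assms
    rat_in_of_int[of "-1"] int_in_neg[of 1]
  by (simp_all add: l_minus)

lemma rat_dom_sum:
  assumes "\<And>x. x \<in> A \<Longrightarrow> rat_dom (f x)"
  shows "rat_dom (sum f A)"
  using assms by (induction A rule: infinite_finite_induct) (use rat_dom_of_int[of 0] in \<open>auto intro: rat_dom_add\<close>)

lemma rat_in_sum:
  assumes "finite A" "\<And>x. x \<in> A \<Longrightarrow> rat_dom (f x)"
  shows "rat_in R (sum f A) = (\<Oplus>x\<in>A. rat_in R (f x))"
  using assms
proof (induction A rule: finite_induct)
  case empty
  then show ?case using rat_in_of_int[of 0] by simp
next
  case (insert x A)
  then show ?case by (simp add: rat_in_add rat_dom_sum Pi_def)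
qed

lemma
  assumes "n > 0" "int_in (int n) \<in> Units R"
  shows rat_dom_inverse: "rat_dom (1 / of_nat n)"
    and rat_in_inverse: "rat_in R (1 / of_nat n) \<otimes> int_in (int n) = \<one>"
  using rat_in_fraction[of "int n" "1 / of_nat n" 1] assms by simp_all

lemma fact_unit:
  assumes "\<And>k. 2 \<le> k \<Longrightarrow> k \<le> n \<Longrightarrow> int_in (int k) \<in> Units R"
  shows "int_in (int (fact n)) \<in> Units R"
  using assms
proof (induction n)
  case (Suc n)
  have "int_in (int (Suc n)) \<in> Units R"
    \<comment> \<open>For \<open>n = 0\<close> the new factor is 1, which the hypothesis on k \<ge>
      2 does not cover.\<close>
    using Suc.prems[of "Suc n"] by (cases "n = 0") auto
  moreover have "int_in (int (fact n)) \<in> Units R" using Suc by simp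
  ultimately show ?case
    by (simp only: fact_Suc of_nat_mult int_in_mult of_nat_id Units_m_closed)
qed simp

lemma rat_dom_inverse_fact:
  assumes "\<And>k. 2 \<le> k \<Longrightarrow> k \<le> n \<Longrightarrow> int_in (int k) \<in> Units R"
  shows "rat_dom (1 / fact n)"
  using rat_dom_inverse[OF _ fact_unit[OF assms]] by simp

end

section \<open>Polynomials in two variables\<close>

lemma (in abelian_monoid) finsum_delta:
  assumes "finite A" and "i \<in> A \<Longrightarrow> a \<in> carrier G"
  shows "(\<Oplus>j\<in>A. if j = i then a else \<zero>) = (if i \<in> A then a else \<zero>)"
proof (cases "i \<in> A")
  case True
  then show ?thesis
    using add.finprod_singleton_swap[of i A "\<lambda>_. a"] assms by simp
next
  case False
  then have "(\<Oplus>j\<in>A. if j = i then a else \<zero>) = (\<Oplus>j\<in>A. \<zero>)"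
    by (intro finsum_cong') auto
  then show ?thesis using False by simp
qed

lemma (in ideal) finsum_mem:
  assumes "finite A" and "\<And>x. x \<in> A \<Longrightarrow> f x \<in> I"
  shows "finsum R f A \<in> I"
  using assms
proof (induction A rule: finite_induct)
  case (insert x A)
  have "f \<in> A \<rightarrow> carrier R" "f x \<in> carrier R"
    using insert.prems Icarr by auto
  then show ?case
    using insert by (simp add: a_closed)
qed (simp add: zero_closed)

context UP_ring
begin

lemma coeff_finsum:
  assumes "finite A" and "f \<in> A \<rightarrow> carrier P"
  shows "up_ring.coeff P (finsum P f A) n = (\<Oplus>x\<in>A. up_ring.coeff P (f x) n)"
  using assms
proof (induction A rule: finite_induct)
  case (insert x A)
  have "f \<in> A \<rightarrow> carrier P" "f x \<in> carrier P" using insert.prems by auto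
  then have "(\<lambda>x. up_ring.coeff P (f x) n) \<in> A \<rightarrow> carrier R" by (blast intro: coeff_closed)
  then show ?case using insert by (simp add: Pi_def)
qed simp

lemma coeff_minus:
  assumes "p \<in> carrier P" "q \<in> carrier P"
  shows "up_ring.coeff P (p \<ominus>\<^bsub>P\<^esub> q) n = up_ring.coeff P p n \<ominus> up_ring.coeff P q n"
  using assms by (simp add: a_minus_def)

lemma coeff_monom_one_mult:
  assumes p: "p \<in> carrier P"
  shows "up_ring.coeff P (up_ring.monom P \<one> m \<otimes>\<^bsub>P\<^esub> p) n = (if n < m then \<zero> else up_ring.coeff P p (n - m))"
proof -
  have "up_ring.coeff P (up_ring.monom P \<one> m \<otimes>\<^bsub>P\<^esub> p) n = (\<Oplus>i\<in>{..n}. if i = m then up_ring.coeff P p (n - m) else \<zero>)"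
    unfolding coeff_mult[OF monom_closed[OF R.one_closed] p]
    by (rule R.finsum_cong') (use p in auto)
  then show ?thesis
    using p by (subst (asm) R.finsum_delta) auto
qed

lemma carrier_eq_up: "carrier P = up R"
  unfolding P_def UP_def by simp

lemma coeff_eq_apply: "p \<in> carrier P \<Longrightarrow> up_ring.coeff P p = p"
  unfolding P_def UP_def by (simp add: restrict_def)

text \<open>The quotient is the shifted coefficient sequence. As the base ring is arbitrary, this
  serves for t over R as well as for u over R[t].\<close>

lemma monom_one_mult_dvd:
  assumes p: "p \<in> carrier P" and low: "\<And>k. k < m \<Longrightarrow> up_ring.coeff P p k = \<zero>"
  shows "\<exists>q\<in>carrier P. up_ring.monom P \<one> m \<otimes>\<^bsub>P\<^esub> q = p
    \<and> (\<forall>k. up_ring.coeff P q k = up_ring.coeff P p (k + m))"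
proof -
  define q where "q = (\<lambda>k. up_ring.coeff P p (k + m))"
  have "q \<in> up R"
  proof
    have "bound \<zero> (deg R p) q"
      using deg_aboveD[OF _ p] by (auto simp: q_def)
    then show "\<exists>n. bound \<zero> n q" ..
  qed (use p in \<open>simp add: q_def\<close>)
  then have q: "q \<in> carrier P" by (simp only: carrier_eq_up)
  have c: "up_ring.coeff P q k = up_ring.coeff P p (k + m)" for k
    by (simp only: coeff_eq_apply[OF q]) (simp only: q_def)
  have "up_ring.monom P \<one> m \<otimes>\<^bsub>P\<^esub> q = p"
    by (rule up_eqI) (use p q low in \<open>simp_all add: coeff_monom_one_mult c del: coeff_mult\<close>)
  with q c show ?thesis by blast
qed

end

lemma (in UP_cring) principal_monom_ideal:
  "PIdl\<^bsub>P\<^esub> (up_ring.monom P \<one> m) = {p \<in> carrier P. \<forall>k<m. up_ring.coeff P p k = \<zero>}"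
proof (intro equalityI subsetI)
  fix p assume "p \<in> PIdl\<^bsub>P\<^esub> (up_ring.monom P \<one> m)"
  then obtain q where q: "q \<in> carrier P" "p = q \<otimes>\<^bsub>P\<^esub> up_ring.monom P \<one> m"
    by (auto simp: cgenideal_def)
  then have "p = up_ring.monom P \<one> m \<otimes>\<^bsub>P\<^esub> q" by (simp add: P.m_comm)
  then show "p \<in> {p \<in> carrier P. \<forall>k<m. up_ring.coeff P p k = \<zero>}"
    using q(1) by (simp add: coeff_monom_one_mult del: coeff_mult)
next
  fix p assume "p \<in> {p \<in> carrier P. \<forall>k<m. up_ring.coeff P p k = \<zero>}"
  then obtain q where "q \<in> carrier P" "up_ring.monom P \<one> m \<otimes>\<^bsub>P\<^esub> q = p"
    using monom_one_mult_dvd[of p m] by auto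
  then have "p = q \<otimes>\<^bsub>P\<^esub> up_ring.monom P \<one> m"
    using P.m_comm[of q] by simp
  with \<open>q \<in> carrier P\<close> show "p \<in> PIdl\<^bsub>P\<^esub> (up_ring.monom P \<one> m)"
    unfolding cgenideal_def by blast
qed

section \<open>Coefficients, substitution and exact division in R[t, u]\<close>

locale bivariate_poly = cring

sublocale bivariate_poly \<subseteq> P: UP_cring R "UP R"
  by unfold_locales simp

sublocale bivariate_poly \<subseteq> S: UP_cring "UP R" "UP2 R"
  by unfold_locales simp

context bivariate_poly
begin

text \<open>The first index is the exponent of t and the second that of u, although u is the outer
  variable.\<close>

abbreviation coeff2 :: "(nat \<Rightarrow> nat \<Rightarrow> 'a) \<Rightarrow> nat \<Rightarrow> nat \<Rightarrow> 'a" where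
  "coeff2 f i j \<equiv> up_ring.coeff (UP R) (up_ring.coeff (UP2 R) f j) i"

lemma coeff2_eqI:
  assumes "f \<in> carrier (UP2 R)" "g \<in> carrier (UP2 R)" "\<And>i j. coeff2 f i j = coeff2 g i j"
  shows "f = g"
  using assms by (intro S.up_eqI P.up_eqI) auto

lemma coeff2_mult:
  assumes "f \<in> carrier (UP2 R)" "g \<in> carrier (UP2 R)"
  shows "coeff2 (f \<otimes>\<^bsub>UP2 R\<^esub> g) i j = (\<Oplus>l\<in>{..j}. \<Oplus>k\<in>{..i}. coeff2 f k l \<otimes> coeff2 g (i - k) (j - l))"
  using assms by (simp add: P.coeff_finsum Pi_def)

lemma var_closed [simp]: "var_t R \<in> carrier (UP2 R)" "var_u R \<in> carrier (UP2 R)"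
  by (simp_all add: var_t_def var_u_def)

lemma const2_closed [simp]: "a \<in> carrier R \<Longrightarrow> const2 R a \<in> carrier (UP2 R)"
  by (simp add: const2_def)

lemma coeff2_const2_mult:
  assumes "a \<in> carrier R" "f \<in> carrier (UP2 R)"
  shows "coeff2 (const2 R a \<otimes>\<^bsub>UP2 R\<^esub> f) i j = a \<otimes> coeff2 f i j"
  using assms unfolding const2_def
  by (simp add: S.monom_mult_is_smult P.monom_mult_is_smult del: P.coeff_mult S.coeff_mult)

lemma coeff2_var_t_mult:
  assumes "f \<in> carrier (UP2 R)"
  shows "coeff2 (var_t R \<otimes>\<^bsub>UP2 R\<^esub> f) i j = (if i = 0 then \<zero> else coeff2 f (i - 1) j)"
  using assms unfolding var_t_def
  by (simp add: S.monom_mult_is_smult P.coeff_monom_one_mult del: P.coeff_mult S.coeff_mult)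

lemma coeff2_var_u_mult:
  assumes "f \<in> carrier (UP2 R)"
  shows "coeff2 (var_u R \<otimes>\<^bsub>UP2 R\<^esub> f) i j = (if j = 0 then \<zero> else coeff2 f i (j - 1))"
  using assms unfolding var_u_def
  by (simp add: S.coeff_monom_one_mult del: P.coeff_mult S.coeff_mult)

lemma var_t_pow: "var_t R [^]\<^bsub>UP2 R\<^esub> (n :: nat) = up_ring.monom (UP2 R) (up_ring.monom (UP R) \<one> n) 0"
  by (simp add: var_t_def S.monom_pow P.monom_pow)

lemma var_u_pow: "var_u R [^]\<^bsub>UP2 R\<^esub> (n :: nat) = up_ring.monom (UP2 R) \<one>\<^bsub>UP R\<^esub> n"
  by (simp add: var_u_def S.monom_pow)

lemma coeff2_var_t_pow: "coeff2 (var_t R [^]\<^bsub>UP2 R\<^esub> (n :: nat)) i j = (if i = n \<and> j = 0 then \<one> else \<zero>)"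
  by (simp add: var_t_pow)

lemma coeff2_var_u_pow: "coeff2 (var_u R [^]\<^bsub>UP2 R\<^esub> (n :: nat)) i j = (if i = 0 \<and> j = n then \<one> else \<zero>)"
  by (simp add: var_u_pow)

text \<open>Multiplication by t + u adds the coefficients shifted in \<open>i\<close> and in
  \<open>j\<close>, which is Pascal's rule.\<close>

lemma coeff2_var_sum_pow:
  "coeff2 ((var_t R \<oplus>\<^bsub>UP2 R\<^esub> var_u R) [^]\<^bsub>UP2 R\<^esub> (n :: nat)) i j
    = (if i + j = n then add_pow R (n choose i) \<one> else \<zero>)"
proof (induction n arbitrary: i j)
  case (Suc n)
  let ?s = "var_t R \<oplus>\<^bsub>UP2 R\<^esub> var_u R"
  have "?s [^]\<^bsub>UP2 R\<^esub> Suc n = var_t R \<otimes>\<^bsub>UP2 R\<^esub> ?s [^]\<^bsub>UP2 R\<^esub> n \<oplus>\<^bsub>UP2 R\<^esub> var_u R \<otimes>\<^bsub>UP2 R\<^esub> ?s [^]\<^bsub>UP2 R\<^esub> n"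
    by (simp add: S.P.m_comm[of _ ?s] S.P.l_distr)
  then have "coeff2 (?s [^]\<^bsub>UP2 R\<^esub> Suc n) i j
      = (if i = 0 then \<zero> else coeff2 (?s [^]\<^bsub>UP2 R\<^esub> n) (i - 1) j)
        \<oplus> (if j = 0 then \<zero> else coeff2 (?s [^]\<^bsub>UP2 R\<^esub> n) i (j - 1))"
    by (simp add: coeff2_var_t_mult coeff2_var_u_mult del: P.coeff_mult S.coeff_mult S.P.nat_pow_Suc)
  also have "\<dots> = (if i + j = Suc n then add_pow R (Suc n choose i) \<one> else \<zero>)"
    unfolding Suc.IH
    by (cases i; cases j) (auto simp: add.nat_pow_mult a_comm)
  finally show ?case .
qed simp

lemma subst2_eq:
  assumes "p \<in> carrier (UP R)"
  shows "subst2 R p s = (\<Oplus>\<^bsub>UP2 R\<^esub>m\<in>{..deg R p}. const2 R (up_ring.coeff (UP R) p m) \<otimes>\<^bsub>UP2 R\<^esub> s [^]\<^bsub>UP2 R\<^esub> m)"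
  unfolding subst2_def by (rule P.eval_on_carrier[OF assms])

lemma subst2_closed [simp]:
  assumes "p \<in> carrier (UP R)" "s \<in> carrier (UP2 R)"
  shows "subst2 R p s \<in> carrier (UP2 R)"
  using assms by (auto simp: subst2_eq intro!: S.P.finsum_closed)

text \<open>Made for s = t, u and t + u, whose m-th power is homogeneous of degree m: at most one
  power contributes to t^i u^j. If its exponent n exceeds the degree of p, both sides
  vanish.\<close>

lemma coeff2_subst2:
  assumes p: "p \<in> carrier (UP R)" and s: "s \<in> carrier (UP2 R)"
    and a: "a \<in> carrier R" "\<And>m. coeff2 (s [^]\<^bsub>UP2 R\<^esub> m) i j = (if m = n then a else \<zero>)"
  shows "coeff2 (subst2 R p s) i j = up_ring.coeff (UP R) p n \<otimes> a"
proof -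
  have "coeff2 (subst2 R p s) i j
      = (\<Oplus>m\<in>{..deg R p}. if m = n then up_ring.coeff (UP R) p n \<otimes> a else \<zero>)"
    using p s a(1)
    by (simp add: subst2_eq S.coeff_finsum P.coeff_finsum Pi_def coeff2_const2_mult a(2)
          del: P.coeff_mult S.coeff_mult)
       (intro finsum_cong', auto)
  also have "\<dots> = up_ring.coeff (UP R) p n \<otimes> a"
    using p a(1) P.deg_aboveD[of p n] by (subst finsum_delta) auto
  finally show ?thesis .
qed

lemma coeff2_subst2_var_t:
  assumes "p \<in> carrier (UP R)"
  shows "coeff2 (subst2 R p (var_t R)) i j = (if j = 0 then up_ring.coeff (UP R) p i else \<zero>)"
  by (subst coeff2_subst2[where n = i and a = "if j = 0 then \<one> else \<zero>"])
     (use assms in \<open>auto simp: coeff2_var_t_pow\<close>)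

lemma coeff2_subst2_var_u:
  assumes "p \<in> carrier (UP R)"
  shows "coeff2 (subst2 R p (var_u R)) i j = (if i = 0 then up_ring.coeff (UP R) p j else \<zero>)"
  by (subst coeff2_subst2[where n = j and a = "if i = 0 then \<one> else \<zero>"])
     (use assms in \<open>auto simp: coeff2_var_u_pow\<close>)

lemma coeff2_subst2_var_sum:
  assumes "p \<in> carrier (UP R)"
  shows "coeff2 (subst2 R p (var_t R \<oplus>\<^bsub>UP2 R\<^esub> var_u R)) i j
    = add_pow R ((i + j) choose i) (up_ring.coeff (UP R) p (i + j))"
  by (subst coeff2_subst2[where n = "i + j" and a = "add_pow R ((i + j) choose i) \<one>"])
     (use assms in \<open>auto simp: coeff2_var_sum_pow add_pow_rdistr\<close>)

lemma exact_quotient_unique: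
  assumes "q \<in> carrier (UP2 R)" "b \<otimes>\<^bsub>UP2 R\<^esub> q = f"
    and "\<And>q'. q' \<in> carrier (UP2 R) \<Longrightarrow> b \<otimes>\<^bsub>UP2 R\<^esub> q' = f \<Longrightarrow> q' = q"
  shows "exact_quotient (UP2 R) f b = q"
  unfolding exact_quotient_def
  by (rule the_equality) (simp_all add: assms(1,2), simp add: assms(3))

lemma exact_quotient_var_u:
  assumes f: "f \<in> carrier (UP2 R)" and 0: "\<And>i. coeff2 f i 0 = \<zero>"
  shows "exact_quotient (UP2 R) f (var_u R) \<in> carrier (UP2 R)"
    and "coeff2 (exact_quotient (UP2 R) f (var_u R)) i j = coeff2 f i (Suc j)"
proof -
  have "up_ring.coeff (UP2 R) f 0 = \<zero>\<^bsub>UP R\<^esub>"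
    using f 0 by (intro P.up_eqI) auto
  then obtain q where q: "q \<in> carrier (UP2 R)" "var_u R \<otimes>\<^bsub>UP2 R\<^esub> q = f"
      "\<And>k. up_ring.coeff (UP2 R) q k = up_ring.coeff (UP2 R) f (k + 1)"
    using S.monom_one_mult_dvd[OF f, of 1] unfolding var_u_def by auto
  have "exact_quotient (UP2 R) f (var_u R) = q"
  proof (rule exact_quotient_unique[OF q(1,2)])
    fix q' assume q': "q' \<in> carrier (UP2 R)" "var_u R \<otimes>\<^bsub>UP2 R\<^esub> q' = f"
    have "coeff2 q' i j = coeff2 f i (Suc j)" for i j
      using coeff2_var_u_mult[OF q'(1), where i = i and j = "Suc j"] q'(2) by simp
    then show "q' = q" using q(1,3) q'(1) by (intro coeff2_eqI) auto
  qed
  then show "exact_quotient (UP2 R) f (var_u R) \<in> carrier (UP2 R)"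
    "coeff2 (exact_quotient (UP2 R) f (var_u R)) i j = coeff2 f i (Suc j)"
    using q by simp_all
qed

text \<open>Unlike u, the inner variable t has to be divided out of the coefficient of each u^j
  separately. The chosen quotients vanish beyond the degree in u, so together they form a
  polynomial.\<close>

lemma exact_quotient_var_t:
  assumes f: "f \<in> carrier (UP2 R)" and 0: "\<And>j. coeff2 f 0 j = \<zero>"
  shows "exact_quotient (UP2 R) f (var_t R) \<in> carrier (UP2 R)"
    and "coeff2 (exact_quotient (UP2 R) f (var_t R)) i j = coeff2 f (Suc i) j"
proof -
  define q where "q = (\<lambda>j. SOME r. r \<in> carrier (UP R) \<and>
    (\<forall>i. up_ring.coeff (UP R) r i = coeff2 f (Suc i) j))"
  have ex: "\<exists>r. r \<in> carrier (UP R) \<and> (\<forall>i. up_ring.coeff (UP R) r i = coeff2 f (Suc i) j)" for j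
    using P.monom_one_mult_dvd[of "up_ring.coeff (UP2 R) f j" 1] 0[of j] S.coeff_closed[OF f] by auto
  have q: "q j \<in> carrier (UP R)" "up_ring.coeff (UP R) (q j) i = coeff2 f (Suc i) j" for i j
    unfolding q_def using someI_ex[OF ex[of j]] by blast+
  have up: "q \<in> up (UP R)"
  proof
    have "q j = \<zero>\<^bsub>UP R\<^esub>" if "deg (UP R) f < j" for j
      using S.deg_aboveD[OF that f] q by (intro P.up_eqI) auto
    then show "\<exists>n. bound \<zero>\<^bsub>UP R\<^esub> n q" by (auto intro!: exI bound.intro)
  qed (rule q)
  then have qS: "q \<in> carrier (UP2 R)" by (simp only: S.carrier_eq_up)
  have qc: "coeff2 q i j = coeff2 f (Suc i) j" for i j
    by (simp add: S.coeff_eq_apply[OF qS] q(2))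
  have "exact_quotient (UP2 R) f (var_t R) = q"
  proof (rule exact_quotient_unique[OF qS])
    show "var_t R \<otimes>\<^bsub>UP2 R\<^esub> q = f"
      using f qS 0 by (intro coeff2_eqI) (auto simp: coeff2_var_t_mult qc simp del: P.coeff_mult S.coeff_mult)
    fix q' assume q': "q' \<in> carrier (UP2 R)" "var_t R \<otimes>\<^bsub>UP2 R\<^esub> q' = f"
    have "coeff2 q' i j = coeff2 f (Suc i) j" for i j
      using coeff2_var_t_mult[OF q'(1), where i = "Suc i" and j = j] q'(2) by simp
    then show "q' = q" using qS qc q'(1) by (intro coeff2_eqI) auto
  qed
  then show "exact_quotient (UP2 R) f (var_t R) \<in> carrier (UP2 R)"
    "coeff2 (exact_quotient (UP2 R) f (var_t R)) i j = coeff2 f (Suc i) j"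
    by (simp_all only: qS qc)
qed

end

section \<open>The functional equation in terms of coefficients\<close>

context bivariate_poly
begin

text \<open>For phi with coefficients \<open>a k\<close>, this is the coefficient of t^i u^j on the
  left-hand side: the first sum comes from phi(u) (phi(t + u) - phi(t)) / u, the second from phi(t)
  (phi(t + u) - phi(u)) / t. Division by a variable causes the shift by 1.\<close>

definition eqn_coeff :: "(nat \<Rightarrow> 'a) \<Rightarrow> nat \<Rightarrow> nat \<Rightarrow> 'a" where
  "eqn_coeff a i j =
     (\<Oplus>k\<in>{..j}. a k \<otimes> add_pow R ((i + (j - k) + 1) choose i) (a (i + (j - k) + 1)))
     \<oplus> (\<Oplus>k\<in>{..i}. a k \<otimes> add_pow R (((i - k) + j + 1) choose j) (a ((i - k) + j + 1)))"

lemma coeff2_minus: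
  assumes "f \<in> carrier (UP2 R)" "g \<in> carrier (UP2 R)"
  shows "coeff2 (f \<ominus>\<^bsub>UP2 R\<^esub> g) i j = coeff2 f i j \<ominus> coeff2 g i j"
  using assms by (simp add: S.coeff_minus P.coeff_minus)

lemma coeff2_subst2_var_t_mult:
  assumes p: "p \<in> carrier (UP R)" and g: "g \<in> carrier (UP2 R)"
  shows "coeff2 (subst2 R p (var_t R) \<otimes>\<^bsub>UP2 R\<^esub> g) i j
    = (\<Oplus>k\<in>{..i}. up_ring.coeff (UP R) p k \<otimes> coeff2 g (i - k) j)"
proof -
  have s: "(\<Oplus>k\<in>{..i}. up_ring.coeff (UP R) p k \<otimes> coeff2 g (i - k) j) \<in> carrier R"
    using p g by (auto intro!: finsum_closed)
  have "coeff2 (subst2 R p (var_t R) \<otimes>\<^bsub>UP2 R\<^esub> g) i j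
    = (\<Oplus>l\<in>{..j}. if l = 0 then \<Oplus>k\<in>{..i}. up_ring.coeff (UP R) p k \<otimes> coeff2 g (i - k) j else \<zero>)"
    unfolding coeff2_mult[OF subst2_closed[OF p var_closed(1)] g] coeff2_subst2_var_t[OF p]
    using p g s by (intro finsum_cong') (auto intro!: add.finprod_one_eqI)
  then show ?thesis
    using s by (subst (asm) finsum_delta) auto
qed

lemma coeff2_subst2_var_u_mult:
  assumes p: "p \<in> carrier (UP R)" and g: "g \<in> carrier (UP2 R)"
  shows "coeff2 (subst2 R p (var_u R) \<otimes>\<^bsub>UP2 R\<^esub> g) i j
    = (\<Oplus>k\<in>{..j}. up_ring.coeff (UP R) p k \<otimes> coeff2 g i (j - k))"
proof -
  have "(\<Oplus>k\<in>{..i}. (if k = 0 then up_ring.coeff (UP R) p l else \<zero>) \<otimes> coeff2 g (i - k) (j - l))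
      = up_ring.coeff (UP R) p l \<otimes> coeff2 g i (j - l)" for l
  proof -
    have "(\<Oplus>k\<in>{..i}. (if k = 0 then up_ring.coeff (UP R) p l else \<zero>) \<otimes> coeff2 g (i - k) (j - l))
      = (\<Oplus>k\<in>{..i}. if k = 0 then up_ring.coeff (UP R) p l \<otimes> coeff2 g i (j - l) else \<zero>)"
      using p g by (intro finsum_cong') auto
    then show ?thesis
      using p g by (subst (asm) finsum_delta) auto
  qed
  then show ?thesis
    by (simp add: coeff2_mult[OF subst2_closed[OF p var_closed(2)] g] coeff2_subst2_var_u[OF p]
        del: P.coeff_mult S.coeff_mult)
qed

lemma
  assumes p: "p \<in> carrier (UP R)"
  shows eqn_lhs_closed: "eqn_lhs R p \<in> carrier (UP2 R)"
    and coeff2_eqn_lhs: "coeff2 (eqn_lhs R p) i j = eqn_coeff (up_ring.coeff (UP R) p) i j"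
proof -
  let ?c = "up_ring.coeff (UP R) p"
  define pt pu ptu where "pt = subst2 R p (var_t R)" and "pu = subst2 R p (var_u R)"
    and "ptu = subst2 R p (var_t R \<oplus>\<^bsub>UP2 R\<^esub> var_u R)"
  have closed: "pt \<in> carrier (UP2 R)" "pu \<in> carrier (UP2 R)" "ptu \<in> carrier (UP2 R)"
    using p by (simp_all add: pt_def pu_def ptu_def)
  define q where "q = exact_quotient (UP2 R) (ptu \<ominus>\<^bsub>UP2 R\<^esub> pt) (var_u R)"
  define r where "r = exact_quotient (UP2 R) (ptu \<ominus>\<^bsub>UP2 R\<^esub> pu) (var_t R)"
  have dt: "coeff2 (ptu \<ominus>\<^bsub>UP2 R\<^esub> pt) i j
      = add_pow R ((i + j) choose i) (?c (i + j)) \<ominus> (if j = 0 then ?c i else \<zero>)" for i j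
    using p closed by (simp only: coeff2_minus) (simp add: pt_def ptu_def coeff2_subst2_var_t coeff2_subst2_var_sum)
  have du: "coeff2 (ptu \<ominus>\<^bsub>UP2 R\<^esub> pu) i j
      = add_pow R ((i + j) choose i) (?c (i + j)) \<ominus> (if i = 0 then ?c j else \<zero>)" for i j
    using p closed by (simp only: coeff2_minus) (simp add: pu_def ptu_def coeff2_subst2_var_u coeff2_subst2_var_sum)
  have minus_zero: "x \<ominus> \<zero> = x" if "x \<in> carrier R" for x
    using that by (simp add: a_minus_def)
  have dt0: "coeff2 (ptu \<ominus>\<^bsub>UP2 R\<^esub> pt) i 0 = \<zero>" for i
    unfolding dt using p by (simp add: r_neg a_minus_def)
  have du0: "coeff2 (ptu \<ominus>\<^bsub>UP2 R\<^esub> pu) 0 j = \<zero>" for j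
    unfolding du using p by (simp add: r_neg a_minus_def)
  have q: "q \<in> carrier (UP2 R)" "coeff2 q i j = add_pow R ((i + j + 1) choose i) (?c (i + j + 1))" for i j
    unfolding q_def using exact_quotient_var_u[OF S.P.minus_closed[OF closed(3,1)] dt0] p
    by (simp_all add: dt minus_zero del: binomial_Suc_Suc)
  \<comment> \<open>Division by t yields the binomial coefficient over \<open>Suc i\<close>;
    symmetry rewrites it over \<open>j\<close>, which makes the formulas for \<open>q\<close> and
    \<open>r\<close> mirror images.\<close>
  have r: "r \<in> carrier (UP2 R)" "coeff2 r i j = add_pow R ((i + j + 1) choose j) (?c (i + j + 1))" for i j
    unfolding r_def using exact_quotient_var_t[OF S.P.minus_closed[OF closed(3,2)] du0] p
      binomial_symmetric[of j "Suc (i + j)"]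
    by (simp_all add: du minus_zero del: binomial_Suc_Suc)
  have lhs: "eqn_lhs R p = pu \<otimes>\<^bsub>UP2 R\<^esub> q \<oplus>\<^bsub>UP2 R\<^esub> pt \<otimes>\<^bsub>UP2 R\<^esub> r"
    unfolding eqn_lhs_def Let_def q_def r_def pt_def pu_def ptu_def ..
  show "eqn_lhs R p \<in> carrier (UP2 R)"
    unfolding lhs using closed q r by simp
  have "coeff2 (eqn_lhs R p) i j = coeff2 (pu \<otimes>\<^bsub>UP2 R\<^esub> q) i j \<oplus> coeff2 (pt \<otimes>\<^bsub>UP2 R\<^esub> r) i j"
    unfolding lhs using closed q(1) r(1) by (simp del: P.coeff_mult S.coeff_mult)
  also have "\<dots> = eqn_coeff ?c i j"
    unfolding pt_def pu_def eqn_coeff_def coeff2_subst2_var_t_mult[OF p r(1)]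
      coeff2_subst2_var_u_mult[OF p q(1)] q(2) r(2) ..
  finally show "coeff2 (eqn_lhs R p) i j = eqn_coeff ?c i j" .
qed

lemma
  assumes p: "p \<in> carrier (UP R)"
  shows eqn_rhs_closed: "eqn_rhs R p \<in> carrier (UP2 R)"
    and coeff2_eqn_rhs: "coeff2 (eqn_rhs R p) i j
      = \<ominus> add_pow R ((i + j) choose i) (up_ring.coeff (UP R) p (i + j))"
  using p by (simp_all add: eqn_rhs_def coeff2_subst2_var_sum)

section \<open>The truncation ideals and their cosets\<close>

lemma low_coeff2_ideal:
  "ideal {f \<in> carrier (UP2 R). \<forall>i j. i + j < d \<longrightarrow> coeff2 f i j = \<zero>} (UP2 R)" (is "ideal ?J _")
proof (rule idealI[OF S.P.ring_axioms])
  show "subgroup ?J (add_monoid (UP2 R))"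
    by (rule S.P.add.subgroupI) (auto simp flip: a_inv_def)
  have mult: "f \<otimes>\<^bsub>UP2 R\<^esub> g \<in> ?J" if f: "f \<in> ?J" and g: "g \<in> carrier (UP2 R)" for f g
  proof -
    have "coeff2 (f \<otimes>\<^bsub>UP2 R\<^esub> g) i j = \<zero>" if "i + j < d" for i j
    proof -
      \<comment> \<open>The indices of \<open>f\<close> in the convolution do not exceed (i, j), so
        their sum stays below \<open>d\<close> and the factor from \<open>f\<close> is zero.\<close>
      have "coeff2 f k l \<otimes> coeff2 g (i - k) (j - l) = \<zero>" if "k \<le> i" "l \<le> j" for k l
        using f g that \<open>i + j < d\<close> by auto
      then show ?thesis
        using f g by (subst coeff2_mult) (auto intro!: add.finprod_one_eqI)
    qed
    then show ?thesis using f g by auto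
  qed
  fix f g assume f: "f \<in> ?J" and g: "g \<in> carrier (UP2 R)"
  show "f \<otimes>\<^bsub>UP2 R\<^esub> g \<in> ?J" by (rule mult[OF f g])
  moreover have "g \<otimes>\<^bsub>UP2 R\<^esub> f = f \<otimes>\<^bsub>UP2 R\<^esub> g" using f g by (auto intro: S.P.m_comm)
  ultimately show "g \<otimes>\<^bsub>UP2 R\<^esub> f \<in> ?J" by simp
qed

text \<open>For the harder inclusion, the coefficient of u^j in f is divisible by t^(N-1-j), so its
  summand is a multiple of the generator t^(N-1-j) u^j. Truncated subtraction gives the exponent 0
  once j \<ge> N - 1, where no condition is imposed.\<close>

lemma ideal_I_eq:
  "ideal_I R N = {f \<in> carrier (UP2 R). \<forall>i j. i + j < N - 1 \<longrightarrow> coeff2 f i j = \<zero>}" (is "_ = ?J")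
proof
  let ?M = "{(var_t R [^]\<^bsub>UP2 R\<^esub> i) \<otimes>\<^bsub>UP2 R\<^esub> (var_u R [^]\<^bsub>UP2 R\<^esub> j) | i j :: nat. i + j \<ge> N - 1}"
  have M: "?M \<subseteq> carrier (UP2 R)" by auto
  have monomials: "(var_t R [^]\<^bsub>UP2 R\<^esub> i) \<otimes>\<^bsub>UP2 R\<^esub> (var_u R [^]\<^bsub>UP2 R\<^esub> j)
      = up_ring.monom (UP2 R) (up_ring.monom (UP R) \<one> i) j" for i j :: nat
  proof -
    have "up_ring.monom (UP2 R) (up_ring.monom (UP R) \<one> i \<otimes>\<^bsub>UP R\<^esub> \<one>\<^bsub>UP R\<^esub>) (0 + j)
      = (var_t R [^]\<^bsub>UP2 R\<^esub> i) \<otimes>\<^bsub>UP2 R\<^esub> (var_u R [^]\<^bsub>UP2 R\<^esub> j)"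
      unfolding var_t_pow var_u_pow by (rule S.monom_mult) auto
    then show ?thesis by simp
  qed
  have "?M \<subseteq> ?J"
    by (auto simp: monomials)
  then show "ideal_I R N \<subseteq> ?J"
    unfolding ideal_I_def by (rule S.P.genideal_minimal[OF low_coeff2_ideal])
  interpret I: ideal "ideal_I R N" "UP2 R"
    unfolding ideal_I_def by (rule S.P.genideal_ideal[OF M])
  show "?J \<subseteq> ideal_I R N"
  proof
    fix f assume "f \<in> ?J"
    then have f: "f \<in> carrier (UP2 R)" and low: "\<And>i j. i + j < N - 1 \<Longrightarrow> coeff2 f i j = \<zero>"
      by auto
    have "up_ring.monom (UP2 R) (up_ring.coeff (UP2 R) f j) j \<in> ideal_I R N" for j
    proof -
      have "up_ring.coeff (UP R) (up_ring.coeff (UP2 R) f j) k = \<zero>" if "k < N - 1 - j" for k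
        using low[of k j] that by simp
      then obtain q where q: "q \<in> carrier (UP R)"
          "up_ring.monom (UP R) \<one> (N - 1 - j) \<otimes>\<^bsub>UP R\<^esub> q = up_ring.coeff (UP2 R) f j"
        using P.monom_one_mult_dvd[of "up_ring.coeff (UP2 R) f j" "N - 1 - j"] S.coeff_closed[OF f] by blast
      have "up_ring.monom (UP2 R) (up_ring.monom (UP R) \<one> (N - 1 - j)) j \<in> ?M"
        unfolding monomials by (rule CollectI, rule exI[of _ "N - 1 - j"], rule exI[of _ j]) auto
      then have "up_ring.monom (UP2 R) (up_ring.monom (UP R) \<one> (N - 1 - j)) j \<in> ideal_I R N"
        unfolding ideal_I_def using S.P.genideal_self[OF M] by blast
      then have "up_ring.monom (UP2 R) (up_ring.monom (UP R) \<one> (N - 1 - j)) j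
          \<otimes>\<^bsub>UP2 R\<^esub> up_ring.monom (UP2 R) q 0 \<in> ideal_I R N"
        using q(1) by (intro I.I_r_closed) auto
      also have "up_ring.monom (UP2 R) (up_ring.monom (UP R) \<one> (N - 1 - j)) j
          \<otimes>\<^bsub>UP2 R\<^esub> up_ring.monom (UP2 R) q 0
        = up_ring.monom (UP2 R) (up_ring.monom (UP R) \<one> (N - 1 - j) \<otimes>\<^bsub>UP R\<^esub> q) (j + 0)"
        using q(1) by (intro S.monom_mult[symmetric]) auto
      finally show ?thesis by (simp only: q(2) add_0_right)
    qed
    then have "(\<Oplus>\<^bsub>UP2 R\<^esub>j\<in>{..deg (UP R) f}. up_ring.monom (UP2 R) (up_ring.coeff (UP2 R) f j) j) \<in> ideal_I R N"
      by (intro I.finsum_mem) auto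
    then show "f \<in> ideal_I R N" by (simp only: S.up_repr[OF f])
  qed
qed

lemma eqn_coeff_cong:
  assumes "\<And>k. k \<le> i + j + 1 \<Longrightarrow> a k = b k" "\<And>k. b k \<in> carrier R"
  shows "eqn_coeff a i j = eqn_coeff b i j"
proof -
  have "(\<Oplus>k\<in>{..j}. a k \<otimes> add_pow R ((i + (j - k) + 1) choose i) (a (i + (j - k) + 1)))
      = (\<Oplus>k\<in>{..j}. b k \<otimes> add_pow R ((i + (j - k) + 1) choose i) (b (i + (j - k) + 1)))"
    using assms by (intro finsum_cong') auto
  moreover have "(\<Oplus>k\<in>{..i}. a k \<otimes> add_pow R (((i - k) + j + 1) choose j) (a ((i - k) + j + 1)))
      = (\<Oplus>k\<in>{..i}. b k \<otimes> add_pow R (((i - k) + j + 1) choose j) (b ((i - k) + j + 1)))"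
    using assms by (intro finsum_cong') auto
  ultimately show ?thesis unfolding eqn_coeff_def by (simp only:)
qed

definition coeff_solution :: "nat \<Rightarrow> (nat \<Rightarrow> 'a) \<Rightarrow> bool" where
  "coeff_solution d a \<longleftrightarrow>
     (\<forall>i j. i + j < d \<longrightarrow> eqn_coeff a i j = \<ominus> add_pow R ((i + j) choose i) (a (i + j)))"

text \<open>The equation at t^i u^j involves \<open>a k\<close> only for k \<le> i + j + 1, and this
  is at most d. With d = N - 1 it says that the choice of a representative modulo t^N does not
  matter.\<close>

lemma coeff_solution_cong:
  assumes "\<And>k. k \<le> d \<Longrightarrow> a k = b k" "\<And>k. b k \<in> carrier R"
  shows "coeff_solution d a \<longleftrightarrow> coeff_solution d b"
  unfolding coeff_solution_def using eqn_coeff_cong[of _ _ a b] assms by simp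

lemma eqn_coset_iff:
  assumes p: "p \<in> carrier (UP R)"
  shows "ideal_I R N +>\<^bsub>UP2 R\<^esub> eqn_lhs R p = ideal_I R N +>\<^bsub>UP2 R\<^esub> eqn_rhs R p
    \<longleftrightarrow> coeff_solution (N - 1) (up_ring.coeff (UP R) p)"
proof -
  have "ideal (ideal_I R N) (UP2 R)"
    unfolding ideal_I_eq by (rule low_coeff2_ideal)
  then have "ideal_I R N +>\<^bsub>UP2 R\<^esub> eqn_lhs R p = ideal_I R N +>\<^bsub>UP2 R\<^esub> eqn_rhs R p
    \<longleftrightarrow> eqn_lhs R p \<ominus>\<^bsub>UP2 R\<^esub> eqn_rhs R p \<in> ideal_I R N"
    using S.P.quotient_eq_iff_same_a_r_cos eqn_lhs_closed[OF p] eqn_rhs_closed[OF p] by blast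
  also have "\<dots> \<longleftrightarrow> (\<forall>i j. i + j < N - 1 \<longrightarrow> coeff2 (eqn_lhs R p) i j = coeff2 (eqn_rhs R p) i j)"
    using eqn_lhs_closed[OF p] eqn_rhs_closed[OF p]
    by (simp add: ideal_I_eq coeff2_minus r_right_minus_eq)
  finally show ?thesis
    unfolding coeff_solution_def coeff2_eqn_lhs[OF p] coeff2_eqn_rhs[OF p] .
qed

lemma trunc_ideal_eq:
  "trunc_ideal R N = {p \<in> carrier (UP R). \<forall>k<N. up_ring.coeff (UP R) p k = \<zero>}"
  unfolding trunc_ideal_def by (rule P.principal_monom_ideal)

lemma trunc_ideal_ideal: "ideal (trunc_ideal R N) (UP R)"
  unfolding trunc_ideal_def by (rule P.P.cgenideal_ideal) simp

lemma trunc_coset_eq_iff: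
  assumes "p \<in> carrier (UP R)" "q \<in> carrier (UP R)"
  shows "trunc_ideal R N +>\<^bsub>UP R\<^esub> p = trunc_ideal R N +>\<^bsub>UP R\<^esub> q
    \<longleftrightarrow> (\<forall>k<N. up_ring.coeff (UP R) p k = up_ring.coeff (UP R) q k)"
  using assms P.P.quotient_eq_iff_same_a_r_cos[OF trunc_ideal_ideal, of p q N, symmetric]
  by (simp add: trunc_ideal_eq P.coeff_minus r_right_minus_eq)

lemma trunc_coset_mem_iff:
  assumes q: "q \<in> carrier (UP R)"
  shows "p \<in> trunc_ideal R N +>\<^bsub>UP R\<^esub> q
    \<longleftrightarrow> p \<in> carrier (UP R) \<and> (\<forall>k<N. up_ring.coeff (UP R) p k = up_ring.coeff (UP R) q k)"
proof -
  interpret ideal "trunc_ideal R N" "UP R" by (rule trunc_ideal_ideal)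
  have "p \<in> trunc_ideal R N +>\<^bsub>UP R\<^esub> q \<longleftrightarrow> p \<in> carrier (UP R)
      \<and> trunc_ideal R N +>\<^bsub>UP R\<^esub> p = trunc_ideal R N +>\<^bsub>UP R\<^esub> q"
    using a_repr_independence'[OF _ q, of p] a_repr_independenceD[of p q]
      P.P.a_r_coset_subset_G[OF a_subset q] by blast
  then show ?thesis using trunc_coset_eq_iff[OF _ q] by blast
qed

lemma is_solution_coset_iff:
  assumes q: "q \<in> carrier (UP R)" and N: "N \<ge> 1"
  shows "is_solution R N (trunc_ideal R N +>\<^bsub>UP R\<^esub> q)
    \<longleftrightarrow> coeff_solution (N - 1) (up_ring.coeff (UP R) q)"
proof -
  have "trunc_ideal R N +>\<^bsub>UP R\<^esub> q \<in> carrier (trunc_poly R N)"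
    using q by (auto simp: FactRing_simps)
  moreover have "coeff_solution (N - 1) (up_ring.coeff (UP R) p) \<longleftrightarrow> coeff_solution (N - 1) (up_ring.coeff (UP R) q)"
    if "p \<in> trunc_ideal R N +>\<^bsub>UP R\<^esub> q" for p
    using that N q by (intro coeff_solution_cong) (auto simp: trunc_coset_mem_iff)
  moreover have "q \<in> trunc_ideal R N +>\<^bsub>UP R\<^esub> q"
    using q by (simp add: trunc_coset_mem_iff)
  ultimately show ?thesis
    unfolding is_solution_def using eqn_coset_iff trunc_coset_mem_iff[OF q] by blast
qed

text \<open>As N \<ge> 1, the constant term is fixed on the whole class, so the image under
  evaluation is a singleton and \<open>the_elem\<close> is determined.\<close>

lemma value_at_0_coset:
  assumes q: "q \<in> carrier (UP R)" and N: "N \<ge> 1"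
  shows "value_at_0 R (trunc_ideal R N +>\<^bsub>UP R\<^esub> q) = up_ring.coeff (UP R) q 0"
proof -
  have ev: "UnivPoly.eval R R id \<zero> p = up_ring.coeff (UP R) p 0" if p: "p \<in> carrier (UP R)" for p
  proof -
    have "UnivPoly.eval R R id \<zero> p = (\<Oplus>i\<in>{..deg R p}. if i = 0 then up_ring.coeff (UP R) p 0 else \<zero>)"
      unfolding P.eval_on_carrier[OF p] using p
      by (intro finsum_cong') (auto simp: nat_pow_zero)
    then show ?thesis using p by (subst (asm) finsum_delta) auto
  qed
  have "UnivPoly.eval R R id \<zero> ` (trunc_ideal R N +>\<^bsub>UP R\<^esub> q) = {up_ring.coeff (UP R) q 0}"
  proof (intro equalityI subsetI)
    fix x assume "x \<in> UnivPoly.eval R R id \<zero> ` (trunc_ideal R N +>\<^bsub>UP R\<^esub> q)"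
    then show "x \<in> {up_ring.coeff (UP R) q 0}"
      using N ev by (auto simp: trunc_coset_mem_iff[OF q])
  next
    fix x assume "x \<in> {up_ring.coeff (UP R) q 0}"
    then show "x \<in> UnivPoly.eval R R id \<zero> ` (trunc_ideal R N +>\<^bsub>UP R\<^esub> q)"
      using ev[OF q] q by (auto simp: trunc_coset_mem_iff[OF q] intro!: image_eqI[of _ _ q])
  qed
  then show ?thesis unfolding value_at_0_def by simp
qed

end

section \<open>Solving for the coefficients\<close>

context bivariate_poly
begin

text \<open>This is c^(1-k), written with natural powers of the inverse;
  \<open>int_pow_eq_weight\<close> makes the identification.\<close>

definition weight :: "'a \<Rightarrow> nat \<Rightarrow> 'a" where
  "weight c k = c \<otimes> inv c [^] k"

lemma weight_0: "c \<in> Units R \<Longrightarrow> weight c 0 = c"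
  by (simp add: weight_def Units_closed)

lemma weight_unit: "c \<in> Units R \<Longrightarrow> weight c k \<in> Units R"
  unfolding weight_def by (intro Units_m_closed) (simp_all add: Units_pow_closed)

lemma weight_closed [simp]: "c \<in> Units R \<Longrightarrow> weight c k \<in> carrier R"
  by (simp add: weight_unit Units_closed)

text \<open>The exponents satisfy (1 - k) + (1 - m) = 1 - l. This is the homogeneity that reduces
  general c to the rational identity.\<close>

lemma weight_mult:
  assumes c: "c \<in> Units R" and km: "k + m = Suc l"
  shows "weight c k \<otimes> weight c m = weight c l"
proof -
  have "weight c k \<otimes> weight c m = c \<otimes> (c \<otimes> (inv c [^] k \<otimes> inv c [^] m))"
    using c Units_closed[OF c] by (simp add: weight_def m_ac)
  also have "inv c [^] k \<otimes> inv c [^] m = inv c [^] l \<otimes> inv c"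
    using c by (simp add: nat_pow_mult km)
  also have "c \<otimes> (c \<otimes> (inv c [^] l \<otimes> inv c)) = c \<otimes> inv c [^] l \<otimes> (c \<otimes> inv c)"
    using c Units_closed[OF c] by (simp add: m_ac del: Units_r_inv)
  finally show ?thesis using c Units_closed[OF c] by (simp add: weight_def)
qed

definition solution_coeff :: "'a \<Rightarrow> nat \<Rightarrow> 'a" where
  "solution_coeff c k = rat_in R (bernoulli_coeff k) \<otimes> weight c k"

lemma scaled_mult:
  assumes c: "c \<in> Units R" and "k + m = Suc l" and x: "rat_dom x" and y: "rat_dom y"
  shows "(rat_in R x \<otimes> weight c k) \<otimes> (rat_in R y \<otimes> weight c m) = rat_in R (x * y) \<otimes> weight c l"
proof -
  have "(rat_in R x \<otimes> weight c k) \<otimes> (rat_in R y \<otimes> weight c m)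
      = (rat_in R x \<otimes> rat_in R y) \<otimes> (weight c k \<otimes> weight c m)"
    using c x y by (simp add: m_ac)
  then show ?thesis
    by (simp only: weight_mult[OF assms(1,2)] rat_in_mult[OF x y])
qed

lemma scaled_add_pow:
  assumes "c \<in> Units R" "rat_dom x"
  shows "add_pow R (n :: nat) (rat_in R x \<otimes> weight c k) = rat_in R (of_nat n * x) \<otimes> weight c k"
  using assms by (simp add: rat_in_mult rat_in_of_nat m_assoc flip: int_in_of_nat_mult)

lemma scaled_sum:
  assumes "c \<in> Units R" "finite A" "\<And>x. x \<in> A \<Longrightarrow> rat_dom (f x)"
  shows "(\<Oplus>x\<in>A. rat_in R (f x) \<otimes> weight c l) = rat_in R (sum f A) \<otimes> weight c l"
  using assms by (simp add: rat_in_sum finsum_ldistr Pi_def)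

text \<open>The linear recursion expresses b n through products of earlier b k with 1 / (n + 1 -
  k)!, and these factorials only involve factors up to n + 1.\<close>

lemma rat_dom_bernoulli_coeff:
  assumes "\<And>k. 2 \<le> k \<Longrightarrow> k \<le> n + 1 \<Longrightarrow> int_in (int k) \<in> Units R"
  shows "rat_dom (bernoulli_coeff n)"
  using assms
proof (induction n rule: less_induct)
  case (less n)
  show ?case
  proof (cases "n = 0")
    case True
    then show ?thesis using rat_dom_of_int[of 1] by (simp add: bernoulli_coeff_0)
  next
    case False
    then have "(\<Sum>k<n. bernoulli_coeff k / fact (n + 1 - k)) + bernoulli_coeff n = 0"
      using bernoulli_coeff_rec[of n] by (simp flip: lessThan_Suc_atMost)
    then have "bernoulli_coeff n = - (\<Sum>k<n. bernoulli_coeff k * (1 / fact (n + 1 - k)))"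
      by (simp add: eq_neg_iff_add_eq_0 add.commute)
    moreover have "rat_dom (bernoulli_coeff k * (1 / fact (n + 1 - k)))" if "k < n" for k
      using that less.prems by (intro rat_dom_mult less.IH rat_dom_inverse_fact) auto
    ultimately show ?thesis by (auto simp only: lessThan_iff intro!: rat_dom_neg rat_dom_sum)
  qed
qed

text \<open>All products in the equation at t^i u^j have indices adding up to i + j + 1, so each
  carries the same factor \<open>weight c (i + j)\<close>; what remains is
  \<open>bernoulli_coeff_equation\<close>.\<close>

lemma solution_coeff_solves:
  assumes c: "c \<in> Units R"
    and units: "\<And>k. 2 \<le> k \<Longrightarrow> k \<le> d + 1 \<Longrightarrow> int_in (int k) \<in> Units R"
    and a: "\<And>k. k \<le> d \<Longrightarrow> a k = solution_coeff c k"
  shows "coeff_solution d a"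
  unfolding coeff_solution_def
proof (intro allI impI)
  fix i j assume ij: "i + j < d"
  have dom: "rat_dom (bernoulli_coeff k)" if "k \<le> d" for k
    using units that by (intro rat_dom_bernoulli_coeff) auto
  have prod: "a k \<otimes> add_pow R n (a m)
      = rat_in R (bernoulli_coeff k * (of_nat n * bernoulli_coeff m)) \<otimes> weight c (i + j)"
    if "k + m = Suc (i + j)" for k m n :: nat
    using that ij scaled_mult[OF c that] dom
    by (simp add: a solution_coeff_def scaled_add_pow[OF c] rat_dom_mult)
  let ?f = "\<lambda>k. bernoulli_coeff k * (of_nat ((i + (j - k) + 1) choose i) * bernoulli_coeff (i + (j - k) + 1))"
  let ?g = "\<lambda>k. bernoulli_coeff k * (of_nat (((i - k) + j + 1) choose j) * bernoulli_coeff ((i - k) + j + 1))"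
  have domf: "rat_dom (?f k)" if "k \<in> {..j}" for k
    using that ij by (intro rat_dom_mult rat_dom_of_nat dom) auto
  have domg: "rat_dom (?g k)" if "k \<in> {..i}" for k
    using that ij by (intro rat_dom_mult rat_dom_of_nat dom) auto
  have "(\<Oplus>k\<in>{..j}. a k \<otimes> add_pow R ((i + (j - k) + 1) choose i) (a (i + (j - k) + 1)))
      = (\<Oplus>k\<in>{..j}. rat_in R (?f k) \<otimes> weight c (i + j))"
    using c domf by (intro finsum_cong' prod) auto
  also have "\<dots> = rat_in R (sum ?f {..j}) \<otimes> weight c (i + j)"
    by (rule scaled_sum[OF c _ domf]) simp_all
  finally have 1: "(\<Oplus>k\<in>{..j}. a k \<otimes> add_pow R ((i + (j - k) + 1) choose i) (a (i + (j - k) + 1)))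
      = rat_in R (sum ?f {..j}) \<otimes> weight c (i + j)" .
  have "(\<Oplus>k\<in>{..i}. a k \<otimes> add_pow R (((i - k) + j + 1) choose j) (a ((i - k) + j + 1)))
      = (\<Oplus>k\<in>{..i}. rat_in R (?g k) \<otimes> weight c (i + j))"
    using c domg by (intro finsum_cong' prod) auto
  also have "\<dots> = rat_in R (sum ?g {..i}) \<otimes> weight c (i + j)"
    by (rule scaled_sum[OF c _ domg]) simp_all
  finally have 2: "(\<Oplus>k\<in>{..i}. a k \<otimes> add_pow R (((i - k) + j + 1) choose j) (a ((i - k) + j + 1)))
      = rat_in R (sum ?g {..i}) \<otimes> weight c (i + j)" .
  have dom': "rat_dom (sum ?f {..j})" "rat_dom (sum ?g {..i})"
    using domf domg by (auto intro: rat_dom_sum)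
  have "eqn_coeff a i j = rat_in R (sum ?f {..j} + sum ?g {..i}) \<otimes> weight c (i + j)"
    unfolding eqn_coeff_def 1 2 rat_in_add[OF dom'] using c dom' by (simp add: l_distr)
  also have "\<dots> = rat_in R (- (of_nat ((i + j) choose i) * bernoulli_coeff (i + j))) \<otimes> weight c (i + j)"
    by (simp only: bernoulli_coeff_equation)
  also have "\<dots> = \<ominus> (rat_in R (of_nat ((i + j) choose i) * bernoulli_coeff (i + j)) \<otimes> weight c (i + j))"
    using c ij dom by (simp add: rat_in_neg rat_dom_mult l_minus)
  also have "\<dots> = \<ominus> add_pow R ((i + j) choose i) (a (i + j))"
    using c ij dom by (simp add: a solution_coeff_def scaled_add_pow)
  finally show "eqn_coeff a i j = \<ominus> add_pow R ((i + j) choose i) (a (i + j))" .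
qed

text \<open>
  Of the products in the coefficient of \<open>u ^ (n - 1)\<close>, those involving \<open>a n\<close> add up to
  \<open>(n + 1) a 0 a n\<close>; all other ones only involve \<open>a 0, \<dots>, a (n - 1)\<close>.
\<close>

lemma eqn_coeff_0:
  assumes a: "\<And>k. a k \<in> carrier R" and n: "n \<ge> 1"
  shows "eqn_coeff a 0 (n - 1) = add_pow R (n + 1) (a 0 \<otimes> a n) \<oplus> (\<Oplus>k\<in>{1..<n}. a k \<otimes> a (n - k))"
proof -
  have "{..n - 1} = insert 0 {1..<n}" using n by auto
  then have "(\<Oplus>k\<in>{..n - 1}. a k \<otimes> a (n - k)) = a 0 \<otimes> a n \<oplus> (\<Oplus>k\<in>{1..<n}. a k \<otimes> a (n - k))"
    using a by (simp add: Pi_def)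
  moreover have "(\<Oplus>k\<in>{..n - 1}. a k \<otimes> add_pow R ((0 + (n - 1 - k) + 1) choose 0) (a (0 + (n - 1 - k) + 1)))
      = (\<Oplus>k\<in>{..n - 1}. a k \<otimes> a (n - k))"
  proof (rule finsum_cong')
    fix k assume "k \<in> {..n - 1}"
    then have "n - 1 - k + 1 = n - k" using n by auto
    then show "a k \<otimes> add_pow R ((0 + (n - 1 - k) + 1) choose 0) (a (0 + (n - 1 - k) + 1)) = a k \<otimes> a (n - k)"
      using a by simp
  qed (use a in auto)
  moreover have "n choose (n - 1) = n" using n binomial_symmetric[of 1 n] by simp
  moreover have "(\<Oplus>k\<in>{1..<n}. a k \<otimes> a (n - k)) \<in> carrier R" using a by (auto intro: finsum_closed)
  ultimately show ?thesis
    unfolding eqn_coeff_def using a n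
    by (simp add: add_pow_rdistr a_ac)
qed

text \<open>The case i = 0 of the rational equation, which is Euler's quadratic recursion for the
  Bernoulli numbers; it is the counterpart of \<open>eqn_coeff_0\<close>.\<close>

lemma bernoulli_coeff_equation_0:
  assumes n: "n \<ge> 1"
  shows "of_nat (n + 1) * bernoulli_coeff n
    = - ((\<Sum>k\<in>{1..<n}. bernoulli_coeff k * bernoulli_coeff (n - k)) + bernoulli_coeff (n - 1))"
proof -
  have "{..n - 1} = insert 0 {1..<n}" using n by auto
  moreover have "n choose (n - 1) = n" using n binomial_symmetric[of 1 n] by simp
  moreover have "(\<Sum>k\<in>{1..<n}. bernoulli_coeff k * bernoulli_coeff (Suc (n - 1 - k)))
      = (\<Sum>k\<in>{1..<n}. bernoulli_coeff k * bernoulli_coeff (n - k))"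
    by (intro sum.cong) (auto simp: Suc_diff_Suc)
  ultimately show ?thesis
    using bernoulli_coeff_equation[where i = 0 and j = "n - 1"] n
    by (simp add: bernoulli_coeff_0 algebra_simps)
qed

lemma coeff_solution_step:
  assumes a: "\<And>k. a k \<in> carrier R" and c: "c \<in> Units R" "a 0 = c" and n: "n \<ge> 1"
    and units: "\<And>k. 2 \<le> k \<Longrightarrow> k \<le> n \<Longrightarrow> int_in (int k) \<in> Units R"
    and prev: "\<And>k. k < n \<Longrightarrow> a k = solution_coeff c k"
    and eqn: "eqn_coeff a 0 (n - 1) = \<ominus> a (n - 1)"
  shows "int_in (int (n + 1)) \<in> Units R" and "a n = solution_coeff c n"
proof -
  let ?b = bernoulli_coeff and ?N = "int_in (int (n + 1))" and ?w = "weight c"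
  have dom: "rat_dom (?b k)" if "k < n" for k
    using units that by (intro rat_dom_bernoulli_coeff) auto
  define s where "s = (\<Sum>k\<in>{1..<n}. ?b k * ?b (n - k))"
  have s: "rat_dom s" unfolding s_def using dom by (auto intro!: rat_dom_sum rat_dom_mult)
  have cc: "c \<in> carrier R" using c by (simp add: Units_closed)
  have dom1: "rat_dom (?b (n - 1))" using dom n by simp
  \<comment> \<open>At this point b n may still have the denominator n + 1; only the product (n + 1)
    b n is known to make sense, being expressed through earlier coefficients.\<close>
  have dom_top: "rat_dom (of_nat (n + 1) * ?b n)"
    unfolding bernoulli_coeff_equation_0[OF n] s_def[symmetric] by (intro rat_dom_neg rat_dom_add s dom1)
  have "(\<Oplus>k\<in>{1..<n}. a k \<otimes> a (n - k)) = (\<Oplus>k\<in>{1..<n}. rat_in R (?b k * ?b (n - k)) \<otimes> ?w (n - 1))"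
    using c dom n by (intro finsum_cong') (auto simp: prev solution_coeff_def scaled_mult rat_dom_mult)
  also have "\<dots> = rat_in R s \<otimes> ?w (n - 1)"
    unfolding s_def using c dom by (intro scaled_sum) (auto intro: rat_dom_mult)
  finally have eq: "add_pow R (n + 1) (c \<otimes> a n) \<oplus> rat_in R s \<otimes> ?w (n - 1) = \<ominus> (rat_in R (?b (n - 1)) \<otimes> ?w (n - 1))"
    using eqn n unfolding eqn_coeff_0[OF a n] by (simp add: c prev solution_coeff_def)
  have neg: "x = \<ominus> (y \<oplus> z)" if "x \<oplus> y = \<ominus> z" "x \<in> carrier R" "y \<in> carrier R" "z \<in> carrier R" for x y z
    using that by (intro minus_equality[symmetric]) (simp_all add: l_neg flip: a_assoc)
  have "add_pow R (n + 1) (c \<otimes> a n)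
      = \<ominus> (rat_in R s \<otimes> ?w (n - 1) \<oplus> rat_in R (?b (n - 1)) \<otimes> ?w (n - 1))"
    by (rule neg[OF eq]) (use c cc a s dom1 in simp_all)
  also have "\<dots> = rat_in R (- (s + ?b (n - 1))) \<otimes> ?w (n - 1)"
    unfolding rat_in_neg[OF rat_dom_add[OF s dom1]] rat_in_add[OF s dom1]
    using c s dom1 by (simp add: l_minus l_distr)
  also have "- (s + ?b (n - 1)) = of_nat (n + 1) * ?b n"
    unfolding s_def by (rule bernoulli_coeff_equation_0[OF n, symmetric])
  also have "?w (n - 1) = c \<otimes> ?w n"
    using weight_mult[OF c(1), of 0 n "n - 1"] n by (simp add: weight_0 c)
  finally have "c \<otimes> add_pow R (n + 1) (a n) = rat_in R (of_nat (n + 1) * ?b n) \<otimes> (c \<otimes> ?w n)"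
    by (simp only: add_pow_rdistr[OF cc a])
  then have "c \<otimes> (?N \<otimes> a n) = c \<otimes> (rat_in R (of_nat (n + 1) * ?b n) \<otimes> ?w n)"
    using c by (simp only: int_in_of_nat_mult[OF a] m_lcomm[OF cc rat_in_closed[OF dom_top] weight_closed])
  then have top: "?N \<otimes> a n = rat_in R (of_nat (n + 1) * ?b n) \<otimes> ?w n"
    using c a dom_top by (subst (asm) Units_l_cancel) auto
  \<comment> \<open>The middle terms of the linear recursion. Since k \<ge> 1, only factorials up to
    n! occur, and these are already invertible.\<close>
  define r where "r = (\<Sum>k\<in>{1..<n}. ?b k * (1 / fact (n + 1 - k)))"
  have r: "rat_dom r" unfolding r_def
    by (intro rat_dom_sum rat_dom_mult rat_dom_inverse_fact) (use dom units in auto)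
  have f: "rat_dom (1 / fact n)" using units by (rule rat_dom_inverse_fact)
  \<comment> \<open>The term k = 0 is 1 / (n + 1)!, and multiplying by n + 1 turns it into 1 / n!;
    the term k = n is b n itself.\<close>
  have "{..n} = insert 0 (insert n {1..<n})" using n by auto
  then have "1 / fact (n + 1) + (?b n + r) = 0"
    using bernoulli_coeff_rec[of n] n by (simp add: r_def bernoulli_coeff_0)
  then have "of_nat (n + 1) * (1 / fact (n + 1)) + (of_nat (n + 1) * ?b n + of_nat (n + 1) * r) = 0"
    by (simp only: distrib_left[symmetric] mult_zero_right)
  moreover have "of_nat (n + 1) * (1 / fact (n + 1)) = (1 / fact n :: rat)"
    by (simp del: of_nat_Suc)
  ultimately have "1 / fact n = - (of_nat (n + 1) * ?b n) + - (of_nat (n + 1) * r)"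
    by (simp only: eq_neg_iff_add_eq_0 flip: minus_add_distrib)
  then have "rat_in R (1 / fact n) = \<ominus> rat_in R (of_nat (n + 1) * ?b n) \<oplus> \<ominus> (?N \<otimes> rat_in R r)"
    using dom_top r by (simp only: rat_in_add rat_in_neg rat_dom_neg rat_dom_mult rat_dom_of_nat rat_in_mult rat_in_of_nat)
  \<comment> \<open>Dividing \<open>top\<close> by the weight exhibits (n + 1) b n as a multiple of
    n + 1 inside R, so 1 / n! is such a multiple too.\<close>
  moreover obtain v where v: "v \<in> carrier R" "?w n \<otimes> v = \<one>"
    using weight_unit[OF c(1)] Units_r_inv_ex by blast
  moreover have "rat_in R (of_nat (n + 1) * ?b n) = ?N \<otimes> (a n \<otimes> v)"
  proof -
    have "?N \<otimes> (a n \<otimes> v) = rat_in R (of_nat (n + 1) * ?b n) \<otimes> ?w n \<otimes> v"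
      using a v by (simp only: top[symmetric] m_assoc int_in_closed)
    also have "\<dots> = rat_in R (of_nat (n + 1) * ?b n) \<otimes> \<one>"
      using c v dom_top by (simp only: m_assoc weight_closed rat_in_closed)
    finally show ?thesis using dom_top by (simp only: r_one rat_in_closed)
  qed
  ultimately have "rat_in R (1 / fact n) = ?N \<otimes> (\<ominus> (a n \<otimes> v) \<oplus> \<ominus> rat_in R r)"
    using a r by (simp only: r_distr r_minus int_in_closed m_closed a_inv_closed rat_in_closed)
  moreover have "rat_in R (1 / fact n) \<otimes> int_in (int (fact n)) = \<one>"
    using rat_in_inverse[OF _ fact_unit[OF units]] by simp
  ultimately have "?N \<otimes> (\<ominus> (a n \<otimes> v) \<oplus> \<ominus> rat_in R r) \<otimes> int_in (int (fact n)) = \<one>" by simp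
  \<comment> \<open>Now n + 1 divides 1, because n! inverts 1 / n!.\<close>
  then have "?N \<otimes> ((\<ominus> (a n \<otimes> v) \<oplus> \<ominus> rat_in R r) \<otimes> int_in (int (fact n))) \<in> Units R"
    using a v r by (simp add: m_assoc)
  then show N: "?N \<in> Units R"
    by (rule unit_divisor[rotated 2]) (use a v r in simp_all)
  have "int_in (int k) \<in> Units R" if "2 \<le> k" "k \<le> n + 1" for k
    using that N units by (cases "k = n + 1") auto
  then have "rat_dom (?b n)" by (rule rat_dom_bernoulli_coeff)
  then have "?N \<otimes> a n = ?N \<otimes> solution_coeff c n"
    unfolding top solution_coeff_def using c by (simp only: rat_in_mult rat_dom_of_nat rat_in_of_nat) (simp add: m_assoc)
  then show "a n = solution_coeff c n"
    using N a c \<open>rat_dom (?b n)\<close> by (subst (asm) Units_l_cancel) (auto simp: solution_coeff_def)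
qed

text \<open>Invertibility of n + 1 and the value of \<open>a n\<close> are carried through one
  induction, because each step needs both for all smaller indices.\<close>

lemma coeff_solution_unique:
  assumes a: "\<And>k. a k \<in> carrier R" and c: "c \<in> Units R" "a 0 = c" and sol: "coeff_solution d a"
    and n: "n \<le> d"
  shows "int_in (int (n + 1)) \<in> Units R \<and> a n = solution_coeff c n"
  using n
proof (induction n rule: less_induct)
  case (less n)
  show ?case
  proof (cases "n = 0")
    case True
    then show ?thesis
      using c rat_in_of_int[of 1] by (simp add: solution_coeff_def weight_0 bernoulli_coeff_0 Units_closed)
  next
    case False
    then have n: "n \<ge> 1" by simp
    have units: "int_in (int k) \<in> Units R" if "2 \<le> k" "k \<le> n" for k
      using less.IH[of "k - 1"] less.prems that by simp
    have prev: "a k = solution_coeff c k" if "k < n" for k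
      using less.IH[OF that] less.prems that by simp
    have "eqn_coeff a 0 (n - 1) = \<ominus> a (n - 1)"
      using sol n less.prems a by (auto simp: coeff_solution_def dest: spec[of _ 0])
    from coeff_solution_step[OF a c n units prev this] show ?thesis by blast
  qed
qed

end

section \<open>The theorem over a commutative ring\<close>

context bivariate_poly
begin

lemma int_pow_eq_weight:
  assumes c: "c \<in> Units R"
  shows "c [^] (1 - int k) = weight c k"
proof (cases k)
  case 0
  then show ?thesis using c Units_closed[OF c] by (simp add: weight_0 int_pow_def2)
next
  case (Suc m)
  have closed: "c \<in> carrier R" "inv c \<in> carrier R" using c by (simp_all add: Units_closed)
  have "c [^] m \<otimes> weight c (Suc m) = (c \<otimes> inv c) [^] Suc m"
    using closed by (simp add: weight_def m_ac nat_pow_distrib del: Units_r_inv)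
  then have "c [^] m \<otimes> weight c (Suc m) = \<one>" using c by simp
  then have "inv (c [^] m) = weight c (Suc m)"
    using c closed by (intro comm_inv_char) simp_all
  moreover have "c [^] (1 - int k) = inv (c [^] m)"
    by (cases "m = 0") (simp_all add: Suc int_pow_def2)
  ultimately show ?thesis by (simp only: Suc)
qed

lemma phi_trunc_coset:
  assumes c: "c \<in> Units R" and dom: "\<And>k. k < N \<Longrightarrow> rat_dom (bernoulli_coeff k)"
  obtains p where "p \<in> carrier (UP R)" "phi_trunc R N c = trunc_ideal R N +>\<^bsub>UP R\<^esub> p"
    "\<And>k. k < N \<Longrightarrow> up_ring.coeff (UP R) p k = solution_coeff c k"
proof -
  define p where "p = (\<Oplus>\<^bsub>UP R\<^esub>k\<in>{..<N}. up_ring.monom (UP R) (solution_coeff c k) k)"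
  have closed: "solution_coeff c k \<in> carrier R" if "k < N" for k
    using c dom[OF that] by (simp add: solution_coeff_def)
  have "p \<in> carrier (UP R)"
    unfolding p_def using closed by (intro P.P.finsum_closed) auto
  moreover have "phi_trunc R N c = trunc_ideal R N +>\<^bsub>UP R\<^esub> p"
    unfolding phi_trunc_def p_def solution_coeff_def bernoulli_coeff_def int_pow_eq_weight[OF c] ..
  moreover have "up_ring.coeff (UP R) p k = solution_coeff c k" if "k < N" for k
  proof -
    have "up_ring.coeff (UP R) p k = (\<Oplus>l\<in>{..<N}. if l = k then solution_coeff c k else \<zero>)"
      unfolding p_def using closed that
      by (subst P.coeff_finsum) (auto intro!: finsum_cong')
    then show ?thesis using closed[OF that] that by (subst (asm) finsum_delta) auto
  qed
  ultimately show thesis by (rule that)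
qed

theorem functional_equation_solutions:
  assumes N: "N \<ge> 2"
  shows "(\<exists>\<Phi>. is_solution R N \<Phi> \<and> value_at_0 R \<Phi> \<in> Units R)
      \<longleftrightarrow> (\<forall>k\<in>{2..N}. int_in (int k) \<in> Units R)" (is "?ex \<longleftrightarrow> ?inv")
    and "\<lbrakk>\<forall>k\<in>{2..N}. int_in (int k) \<in> Units R; c \<in> Units R\<rbrakk> \<Longrightarrow>
      is_solution R N \<Phi> \<and> value_at_0 R \<Phi> = c \<longleftrightarrow> \<Phi> = phi_trunc R N c"
proof -
  \<comment> \<open>A single solution with unit constant term forces all the invertibilities and is
    itself determined, so one argument gives necessity and uniqueness.\<close>
  have necessary: "?inv \<and> \<Phi> = phi_trunc R N c"
    if sol: "is_solution R N \<Phi>" and val: "value_at_0 R \<Phi> = c" and c: "c \<in> Units R" for \<Phi> c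
  proof -
    obtain q where q: "q \<in> carrier (UP R)" and Q: "\<Phi> = trunc_ideal R N +>\<^bsub>UP R\<^esub> q"
      using sol by (auto simp: is_solution_def FactRing_simps)
    let ?a = "up_ring.coeff (UP R) q"
    have "coeff_solution (N - 1) ?a"
      using sol N q by (simp add: Q is_solution_coset_iff)
    moreover have "?a 0 = c" using val N q by (simp add: Q value_at_0_coset)
    ultimately have *: "int_in (int (n + 1)) \<in> Units R \<and> ?a n = solution_coeff c n" if "n \<le> N - 1" for n
      using coeff_solution_unique[of ?a c] P.coeff_closed[OF q] c that by blast
    have inv: ?inv
    proof
      fix k assume "k \<in> {2..N}"
      then show "int_in (int k) \<in> Units R" using *[of "k - 1"] by auto
    qed
    then have "rat_dom (bernoulli_coeff k)" if "k < N" for k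
      using that by (intro rat_dom_bernoulli_coeff) auto
    then obtain p where p: "p \<in> carrier (UP R)" "phi_trunc R N c = trunc_ideal R N +>\<^bsub>UP R\<^esub> p"
        "\<And>k. k < N \<Longrightarrow> up_ring.coeff (UP R) p k = solution_coeff c k"
      using phi_trunc_coset[OF c] by blast
    have "\<Phi> = phi_trunc R N c"
      unfolding p(2) Q using trunc_coset_eq_iff[OF q p(1)] p(3) * N by simp
    with inv show ?thesis ..
  qed
  have sufficient: "is_solution R N (phi_trunc R N c) \<and> value_at_0 R (phi_trunc R N c) = c"
    if inv: ?inv and c: "c \<in> Units R" for c
  proof -
    have "rat_dom (bernoulli_coeff k)" if "k < N" for k
      using that inv by (intro rat_dom_bernoulli_coeff) auto
    then obtain p where p: "p \<in> carrier (UP R)" "phi_trunc R N c = trunc_ideal R N +>\<^bsub>UP R\<^esub> p"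
        "\<And>k. k < N \<Longrightarrow> up_ring.coeff (UP R) p k = solution_coeff c k"
      using phi_trunc_coset[OF c] by blast
    have "coeff_solution (N - 1) (up_ring.coeff (UP R) p)"
      using p(3) inv N by (intro solution_coeff_solves[OF c]) auto
    moreover have "solution_coeff c 0 = c"
      using c rat_in_of_int[of 1] by (simp add: solution_coeff_def weight_0 bernoulli_coeff_0 Units_closed)
    ultimately show ?thesis
      using N p(1) p(3)[of 0] by (simp add: p(2) is_solution_coset_iff value_at_0_coset)
  qed
  \<comment> \<open>Existence is witnessed by the solution with c = 1.\<close>
  show "?ex \<longleftrightarrow> ?inv"
    using necessary sufficient[OF _ Units_one_closed] Units_one_closed by metis
  show "is_solution R N \<Phi> \<and> value_at_0 R \<Phi> = c \<longleftrightarrow> \<Phi> = phi_trunc R N c"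
    if "?inv" "c \<in> Units R" using necessary sufficient that by blast
qed

end

section \<open>Passage from the even part to the superring\<close>

lemma (in comm_superring) even_unit_iff:
  assumes x: "x \<in> G 0"
  shows "x \<in> Units (even_ring K G) \<longleftrightarrow> x \<in> Units K"
proof
  note One_nat_def [simp del]
  interpret E: cring "even_ring K G" by (rule even_cring)
  have E: "carrier (even_ring K G) = G 0" "\<And>a b. a \<otimes>\<^bsub>even_ring K G\<^esub> b = a \<otimes> b" "\<one>\<^bsub>even_ring K G\<^esub> = \<one>"
    by (simp_all add: even_ring_def)
  have xK: "x \<in> carrier K" using x grade_closed[of 0] by simp
  show "x \<in> Units K" if "x \<in> Units (even_ring K G)"
    using that grade_closed[of 0] by (auto simp: Units_def E)
  show "x \<in> Units (even_ring K G)" if unit: "x \<in> Units K"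
  proof -
    interpret G0: additive_subgroup "G 0" K by (rule grade_subgroup) simp
    obtain y where y: "y \<in> carrier K" "x \<otimes> y = \<one>" using Units_r_inv_ex[OF unit] by blast
    then have "y \<in> G 0 <+>\<^bsub>K\<^esub> G 1" by (simp only: grade_sum)
    then obtain y0 y1 where y0: "y0 \<in> G 0" and y1: "y1 \<in> G 1" and sum: "y = y0 \<oplus> y1"
      unfolding set_add_def' by blast
    have closed: "y0 \<in> carrier K" "y1 \<in> carrier K"
      using y0 y1 grade_closed[of 0 y0] grade_closed[of 1 y1] by simp_all
    have even: "x \<otimes> y0 \<in> G 0" and odd: "x \<otimes> y1 \<in> G 1"
      using grade_mult[of 0 0 x y0] grade_mult[of 0 1 x y1] x y0 y1 by simp_all
    have eq: "x \<otimes> y0 \<oplus> x \<otimes> y1 = \<one>"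
      using y(2) xK closed by (simp add: sum r_distr)
    \<comment> \<open>The odd element x y1 equals 1 - x y0, which is even, so it is zero; hence the
      even component y0 already inverts x.\<close>
    have "x \<otimes> y1 = \<ominus> (x \<otimes> y0) \<oplus> (x \<otimes> y0 \<oplus> x \<otimes> y1)"
      using xK closed by (simp add: r_neg1)
    then have "x \<otimes> y1 \<in> G 0"
      unfolding eq using even one_even by (simp add: G0.a_closed G0.a_inv_closed)
    then have "x \<otimes> y1 = \<zero>" using odd grade_disjoint by blast
    then have "x \<otimes> y0 = \<one>" using eq xK closed by simp
    moreover have "y0 \<otimes> x = x \<otimes> y0"
      using E.m_comm[of y0 x] x y0 by (simp add: E)
    ultimately show ?thesis using x y0 by (auto simp: Units_def E)
  qed
qed

text \<open>Integers are even elements, computed in the same way in both rings, so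
  \<open>even_unit_iff\<close> moves their invertibility from K to its even part.\<close>

lemma (in comm_superring) int_invertible_iff:
  "int_invertible K k \<longleftrightarrow> add_pow (even_ring K G) (int k) \<one>\<^bsub>even_ring K G\<^esub> \<in> Units (even_ring K G)"
proof -
  interpret E: cring "even_ring K G" by (rule even_cring)
  have eq: "add_pow (even_ring K G) k \<one>\<^bsub>even_ring K G\<^esub> = add_pow K k \<one>"
    by (simp add: even_ring_def add_pow_def nat_pow_def)
  have "add_pow (even_ring K G) k \<one>\<^bsub>even_ring K G\<^esub> \<in> carrier (even_ring K G)"
    by simp
  then have "add_pow K k \<one> \<in> G 0"
    unfolding eq by (simp add: even_ring_def)
  then show ?thesis
    by (simp add: int_invertible_def E.int_in_of_nat eq even_unit_iff)
qed

theorem lemma5p2: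
  fixes K :: "('a, 'm) ring_scheme" and G :: "nat \<Rightarrow> 'a set" and N :: nat
  assumes "comm_superring K G" and "N \<ge> 2"
  shows "((\<exists>\<Phi>. is_solution (even_ring K G) N \<Phi> \<and>
              value_at_0 (even_ring K G) \<Phi> \<in> Units (even_ring K G))
          \<longleftrightarrow> (\<forall>k\<in>{2..N}. int_invertible K k))
       \<and> ((\<forall>k\<in>{2..N}. int_invertible K k) \<longrightarrow>
            (\<forall>c\<in>Units (even_ring K G). \<forall>\<Phi>.
               (is_solution (even_ring K G) N \<Phi> \<and> value_at_0 (even_ring K G) \<Phi> = c)
                 \<longleftrightarrow> \<Phi> = phi_trunc (even_ring K G) N c))"
proof -
  interpret K: comm_superring K G by (rule assms(1))
  interpret E: bivariate_poly "even_ring K G"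
    unfolding bivariate_poly_def by (rule K.even_cring)
  show ?thesis
    unfolding K.int_invertible_iff
    using E.functional_equation_solutions[OF assms(2)] by blast
qed

end
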